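(* Let $(\Omega,T)$ be a dynamical system and let $I\subseteq\mathbb{R}$ be an interval. Then the set $$W(I,\Omega)=\{A\in C(I\times\Omega,\mathrm{SL}(2,\mathbb{R})) : A(E,\cdot)\text{ has uniform behavior for each }E\in I\}$$ is a $G_\delta$-set in $C(I\times\Omega,\mathrm{SL}(2,\mathbb{R}))$.
   Context: A dynamical system is a pair $(\Omega,T)$ with $\Omega$ a compact metric space and $T:\Omega\to\Omega$ a homeomorphism. $\mathrm{SL}(2,\mathbb{R})$ is the set of real $2\times2$ matrices of determinant one, and $\|\cdot\|$ is the operator norm. $C(I\times\Omega,\mathrm{SL}(2,\mathbb{R}))$ is the set of continuous maps $I\times\Omega\to\mathrm{SL}(2,\mathbb{R})$, equipped with the topology of local uniform convergence. A continuous map $A:\Omega\to\mathrm{SL}(2,\mathbb{R})$ is called a (continuous) cocycle; for $n\in\mathbb{N}=\{1,2,\dots\}$ put $A_n(\omega)=A(T^{n-1}\omega)\cdots A(T\omega)A(\omega)$. A cocycle $A$ is uniformly hyperbolic if there is $L>0$ with $\liminf_{n\to\infty}\frac1n\log\|A_n(\omega)\|\ge L$ uniformly in $\omega\in\Omega$. A cocycle $A$ has uniform behavior if it is uniformly hyperbolic or $\limsup_{n\to\infty}\frac1n\log\|A_n(\omega)\|=0$ uniformly in $\omega\in\Omega$ (equivalently, $\frac1n\log\|A_n(\cdot)\|\to0$ uniformly on $\Omega$). *)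

theory Defs
  imports "HOL-Analysis.Analysis"
begin

definition dynamical_system :: "'a::metric_space set \<Rightarrow> ('a \<Rightarrow> 'a) \<Rightarrow> bool" where
  "dynamical_system \<Omega> T \<longleftrightarrow> compact \<Omega> \<and> (\<exists>S. homeomorphism \<Omega> \<Omega> T S)"

definition SL2 :: "(real^2^2) set" where
  "SL2 = {M. det M = 1}"

abbreviation opnorm :: "real^2^2 \<Rightarrow> real" where
  "opnorm M \<equiv> onorm ((*v) M)"

text \<open>Maps on a subset \<open>S\<close> of a type are represented by their extensional representatives
  (value \<open>undefined\<close> off \<open>S\<close>), so that equality of functions is equality on \<open>S\<close>.\<close>

definition cont_maps :: "'a::metric_space set \<Rightarrow> 'b::metric_space set \<Rightarrow> ('a \<Rightarrow> 'b) set" where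
  "cont_maps S V = {f \<in> S \<rightarrow>\<^sub>E V. continuous_on S f}"

text \<open>The topology of local uniform convergence, described by uniform closeness on compact
  subsets of \<open>S\<close>. For locally compact \<open>S\<close>, such as the product of an interval with a compact
  space, this coincides with uniform closeness near every point.\<close>

definition loc_unif_openin ::
    "'a::metric_space set \<Rightarrow> 'b::metric_space set \<Rightarrow> ('a \<Rightarrow> 'b) set \<Rightarrow> bool" where
  "loc_unif_openin S V U \<longleftrightarrow> U \<subseteq> cont_maps S V \<and>
     (\<forall>f\<in>U. \<exists>K \<epsilon>. compact K \<and> K \<subseteq> S \<and> \<epsilon> > 0 \<and>
        {g \<in> cont_maps S V. \<forall>x\<in>K. dist (g x) (f x) < \<epsilon>} \<subseteq> U)"

definition loc_unif_topology ::
    "'a::metric_space set \<Rightarrow> 'b::metric_space set \<Rightarrow> ('a \<Rightarrow> 'b) topology" where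
  "loc_unif_topology S V = topology (loc_unif_openin S V)"

lemma istopology_loc_unif_openin: "istopology (loc_unif_openin S V)"
  unfolding istopology_def
proof (intro conjI allI impI)
  fix U W assume U: "loc_unif_openin S V U" and W: "loc_unif_openin S V W"
  show "loc_unif_openin S V (U \<inter> W)"
    unfolding loc_unif_openin_def
  proof (intro conjI ballI)
    show "U \<inter> W \<subseteq> cont_maps S V" using U by (auto simp: loc_unif_openin_def)
    fix f assume f: "f \<in> U \<inter> W"
    obtain K d where K: "compact K" "K \<subseteq> S" "d > 0"
      "{g \<in> cont_maps S V. \<forall>x\<in>K. dist (g x) (f x) < d} \<subseteq> U"
      using U f unfolding loc_unif_openin_def by blast
    obtain K' d' where K': "compact K'" "K' \<subseteq> S" "d' > 0"
      "{g \<in> cont_maps S V. \<forall>x\<in>K'. dist (g x) (f x) < d'} \<subseteq> W"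
      using W f unfolding loc_unif_openin_def by blast
    show "\<exists>K \<epsilon>. compact K \<and> K \<subseteq> S \<and> \<epsilon> > 0 \<and>
        {g \<in> cont_maps S V. \<forall>x\<in>K. dist (g x) (f x) < \<epsilon>} \<subseteq> U \<inter> W"
      by (rule exI[of _ "K \<union> K'"], rule exI[of _ "min d d'"])
        (use K K' in \<open>auto simp: subset_iff\<close>)
  qed
next
  fix \<U> assume *: "\<forall>U\<in>\<U>. loc_unif_openin S V U"
  show "loc_unif_openin S V (\<Union>\<U>)"
    unfolding loc_unif_openin_def
  proof (intro conjI ballI)
    show "\<Union>\<U> \<subseteq> cont_maps S V" using * by (auto simp: loc_unif_openin_def)
    fix f assume "f \<in> \<Union>\<U>"
    then obtain U where "U \<in> \<U>" "f \<in> U" by blast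
    then show "\<exists>K \<epsilon>. compact K \<and> K \<subseteq> S \<and> \<epsilon> > 0 \<and>
        {g \<in> cont_maps S V. \<forall>x\<in>K. dist (g x) (f x) < \<epsilon>} \<subseteq> \<Union>\<U>"
      using * unfolding loc_unif_openin_def by (meson Union_upper subset_trans)
  qed
qed

lemma openin_loc_unif_topology: "openin (loc_unif_topology S V) U \<longleftrightarrow> loc_unif_openin S V U"
  by (simp add: loc_unif_topology_def istopology_loc_unif_openin)

lemma topspace_loc_unif_topology [simp]: "topspace (loc_unif_topology S V) = cont_maps S V"
proof -
  have "loc_unif_openin S V (cont_maps S V)"
    unfolding loc_unif_openin_def by (auto intro!: exI[of _ "{}"] exI[of _ "1::real"])
  then show ?thesis
    by (metis openin_loc_unif_topology loc_unif_openin_def openin_subset openin_topspace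
        subset_antisym)
qed

lemma openin_loc_unif_basic:
  assumes f: "f \<in> cont_maps S V" and K: "compact K" "K \<subseteq> S"
  shows "openin (loc_unif_topology S V) {g \<in> cont_maps S V. \<forall>x\<in>K. dist (g x) (f x) < \<epsilon>}"
  unfolding openin_loc_unif_topology loc_unif_openin_def
proof (intro conjI ballI)
  fix g assume g: "g \<in> {g \<in> cont_maps S V. \<forall>x\<in>K. dist (g x) (f x) < \<epsilon>}"
  have "continuous_on K (\<lambda>x. dist (g x) (f x))"
    using f g K by (auto simp: cont_maps_def intro!: continuous_intros elim: continuous_on_subset)
  then obtain m where m: "m < \<epsilon>" "\<forall>x\<in>K. dist (g x) (f x) \<le> m"
  proof (cases "K = {}")
    case True
    then show ?thesis using that[of "\<epsilon> - 1"] by simp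
  next
    case False
    assume "continuous_on K (\<lambda>x. dist (g x) (f x))"
    then obtain z where "z \<in> K" "\<forall>x\<in>K. dist (g x) (f x) \<le> dist (g z) (f z)"
      using continuous_attains_sup[OF K(1) False] by blast
    then show ?thesis using that[of "dist (g z) (f z)"] g by blast
  qed
  have "dist (h x) (f x) < \<epsilon>" if "\<forall>x\<in>K. dist (h x) (g x) < \<epsilon> - m" "x \<in> K" for h x
    using that m dist_triangle[of "h x" "f x" "g x"] by fastforce
  then show "\<exists>K' \<epsilon>'. compact K' \<and> K' \<subseteq> S \<and> \<epsilon>' > 0 \<and>
      {h \<in> cont_maps S V. \<forall>x\<in>K'. dist (h x) (g x) < \<epsilon>'}
        \<subseteq> {g \<in> cont_maps S V. \<forall>x\<in>K. dist (g x) (f x) < \<epsilon>}"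
    using K m by (intro exI[of _ K] exI[of _ "\<epsilon> - m"]) auto
qed auto

lemma limitin_loc_unif_topology:
  "limitin (loc_unif_topology S V) f l F \<longleftrightarrow>
     l \<in> cont_maps S V \<and> (\<forall>\<^sub>F n in F. f n \<in> cont_maps S V) \<and>
     (\<forall>K. compact K \<and> K \<subseteq> S \<longrightarrow> uniform_limit K f l F)" (is "?L \<longleftrightarrow> ?R")
proof
  assume L: ?L
  then have l: "l \<in> cont_maps S V" by (auto simp: limitin_def)
  have ev: "\<forall>\<^sub>F n in F. f n \<in> cont_maps S V"
    using L l openin_topspace[of "loc_unif_topology S V"] by (auto simp: limitin_def)
  have "uniform_limit K f l F" if K: "compact K" "K \<subseteq> S" for K
    unfolding uniform_limit_iff
  proof (intro allI impI)
    fix e :: real assume "e > 0"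
    then have "l \<in> {g \<in> cont_maps S V. \<forall>x\<in>K. dist (g x) (l x) < e}" using l by simp
    then have "\<forall>\<^sub>F n in F. f n \<in> {g \<in> cont_maps S V. \<forall>x\<in>K. dist (g x) (l x) < e}"
      using L openin_loc_unif_basic[OF l K, of e] unfolding limitin_def by blast
    then show "\<forall>\<^sub>F n in F. \<forall>x\<in>K. dist (f n x) (l x) < e"
      by (rule eventually_mono) auto
  qed
  with l ev show ?R by blast
next
  assume R: ?R
  show ?L
    unfolding limitin_def
  proof (intro conjI allI impI)
    show "l \<in> topspace (loc_unif_topology S V)" using R by simp
    fix U assume "openin (loc_unif_topology S V) U \<and> l \<in> U"
    then obtain K e where K: "compact K" "K \<subseteq> S" "e > 0"
      and U: "{g \<in> cont_maps S V. \<forall>x\<in>K. dist (g x) (l x) < e} \<subseteq> U"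
      unfolding openin_loc_unif_topology loc_unif_openin_def by blast
    have "\<forall>\<^sub>F n in F. \<forall>x\<in>K. dist (f n x) (l x) < e"
      using R K by (auto simp: uniform_limit_iff)
    moreover have "\<forall>\<^sub>F n in F. f n \<in> cont_maps S V" using R by blast
    ultimately show "\<forall>\<^sub>F n in F. f n \<in> U"
      by eventually_elim (use U in auto)
  qed
qed

primrec cocycle_iter :: "('a \<Rightarrow> 'a) \<Rightarrow> ('a \<Rightarrow> real^2^2) \<Rightarrow> nat \<Rightarrow> 'a \<Rightarrow> real^2^2" where
  "cocycle_iter T A 0 \<omega> = mat 1"
| "cocycle_iter T A (Suc n) \<omega> = A ((T ^^ n) \<omega>) ** cocycle_iter T A n \<omega>"

definition growth :: "('a \<Rightarrow> 'a) \<Rightarrow> ('a \<Rightarrow> real^2^2) \<Rightarrow> nat \<Rightarrow> 'a \<Rightarrow> real" where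
  "growth T A n \<omega> = 1 / real n * ln (opnorm (cocycle_iter T A n \<omega>))"

text \<open>A lower bound \<open>L\<close> for the limit inferior, uniformly in \<open>\<omega>\<close>: the threshold beyond which the
  sequence exceeds \<open>L - \<epsilon>\<close> does not depend on \<open>\<omega>\<close>.\<close>

definition uniformly_hyperbolic :: "'a set \<Rightarrow> ('a \<Rightarrow> 'a) \<Rightarrow> ('a \<Rightarrow> real^2^2) \<Rightarrow> bool" where
  "uniformly_hyperbolic \<Omega> T A \<longleftrightarrow>
     (\<exists>L>0. \<forall>\<epsilon>>0. \<forall>\<^sub>F n in sequentially. \<forall>\<omega>\<in>\<Omega>. growth T A n \<omega> > L - \<epsilon>)"

text \<open>The upper bound is uniform in the same sense; the first conjunct makes the limit superior
  equal to zero. By \<open>uniform_zero_growth_iff\<close> below this is uniform convergence to zero.\<close>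

definition uniform_zero_growth :: "'a set \<Rightarrow> ('a \<Rightarrow> 'a) \<Rightarrow> ('a \<Rightarrow> real^2^2) \<Rightarrow> bool" where
  "uniform_zero_growth \<Omega> T A \<longleftrightarrow>
     (\<forall>\<omega>\<in>\<Omega>. limsup (\<lambda>n. ereal (growth T A n \<omega>)) = 0) \<and>
     (\<forall>\<epsilon>>0. \<forall>\<^sub>F n in sequentially. \<forall>\<omega>\<in>\<Omega>. growth T A n \<omega> < \<epsilon>)"

definition uniform_behavior :: "'a set \<Rightarrow> ('a \<Rightarrow> 'a) \<Rightarrow> ('a \<Rightarrow> real^2^2) \<Rightarrow> bool" where
  "uniform_behavior \<Omega> T A \<longleftrightarrow> uniformly_hyperbolic \<Omega> T A \<or> uniform_zero_growth \<Omega> T A"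

lemma opnorm_SL2_ge_1:
  assumes "M \<in> SL2"
  shows "opnorm M \<ge> 1"
proof -
  have bl: "bounded_linear ((*v) M)" by (rule matrix_vector_mul_bounded_linear)
  define u where "u = M *v axis 1 1"
  define v where "v = M *v axis 2 1"
  have "norm u \<le> opnorm M" "norm v \<le> opnorm M"
    using onorm[OF bl, of "axis 1 1"] onorm[OF bl, of "axis 2 1"] by (simp_all add: u_def v_def)
  then have le: "norm u * norm v \<le> opnorm M * opnorm M"
    by (intro mult_mono) (auto simp: onorm_pos_le[OF bl])
  have "u$1 = M$1$1" "u$2 = M$2$1" "v$1 = M$1$2" "v$2 = M$2$2"
    by (simp_all add: u_def v_def matrix_vector_mult_basis column_def)
  then have d: "u$1 * v$2 - v$1 * u$2 = 1"
    using assms by (simp add: SL2_def det_2)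
  have n: "(norm w)\<^sup>2 = (w$1)\<^sup>2 + (w$2)\<^sup>2" for w :: "real^2"
    unfolding power2_norm_eq_inner by (simp add: inner_vec_def sum_2 power2_eq_square)
  have "(norm u * norm v)\<^sup>2 = (u$1 * v$2 - v$1 * u$2)\<^sup>2 + (u$1 * v$1 + u$2 * v$2)\<^sup>2"
    by (simp add: power_mult_distrib n) (simp add: power2_eq_square algebra_simps)
  then have "1 \<le> (norm u * norm v)\<^sup>2" using d by simp
  then have "1 \<le> norm u * norm v"
    by (smt (verit) mult_nonneg_nonneg norm_ge_zero power_less_one_iff one_less_numeral_iff
        power2_less_imp_less one_power2 power_strict_mono zero_less_numeral pos2)
  with le have "1\<^sup>2 \<le> (opnorm M)\<^sup>2" by (simp add: power2_eq_square)
  then show ?thesis using power2_le_imp_le onorm_pos_le[OF bl] by blast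
qed

lemma growth_nonneg:
  assumes A: "A ` \<Omega> \<subseteq> SL2" and T: "T ` \<Omega> \<subseteq> \<Omega>" and w: "\<omega> \<in> \<Omega>"
  shows "growth T A n \<omega> \<ge> 0"
proof -
  have tw: "(T ^^ n) \<omega> \<in> \<Omega>" for n by (induction n) (use T w in auto)
  have "cocycle_iter T A n \<omega> \<in> SL2"
  proof (induction n)
    case 0
    show ?case by (simp add: SL2_def)
  next
    case (Suc n)
    have "A ((T ^^ n) \<omega>) \<in> SL2" using A tw by blast
    then show ?case using Suc by (simp add: SL2_def det_mul)
  qed
  then show ?thesis by (simp add: growth_def opnorm_SL2_ge_1)
qed

lemma uniform_zero_growth_iff:
  assumes "A ` \<Omega> \<subseteq> SL2" and "T ` \<Omega> \<subseteq> \<Omega>"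
  shows "uniform_zero_growth \<Omega> T A \<longleftrightarrow> uniform_limit \<Omega> (growth T A) (\<lambda>_. 0) sequentially"
proof -
  note nn = growth_nonneg[OF assms]
  have eq: "(\<forall>\<omega>\<in>\<Omega>. growth T A n \<omega> < \<epsilon>) \<longleftrightarrow> (\<forall>\<omega>\<in>\<Omega>. dist (growth T A n \<omega>) 0 < \<epsilon>)" for n \<epsilon>
    using nn by (auto simp: dist_real_def)
  have "limsup (\<lambda>n. ereal (growth T A n \<omega>)) = 0"
    if u: "uniform_limit \<Omega> (growth T A) (\<lambda>_. 0) sequentially" and "\<omega> \<in> \<Omega>" for \<omega>
  proof -
    have "(\<lambda>n. growth T A n \<omega>) \<longlonglongrightarrow> 0" using tendsto_uniform_limitI[OF u that(2)] .
    then have "(\<lambda>n. ereal (growth T A n \<omega>)) \<longlonglongrightarrow> 0"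
      by (simp add: zero_ereal_def)
    then show ?thesis by (intro lim_imp_Limsup) auto
  qed
  then show ?thesis
    unfolding uniform_zero_growth_def eq uniform_limit_iff by auto
qed

definition W_set :: "real set \<Rightarrow> 'a::metric_space set \<Rightarrow> ('a \<Rightarrow> 'a) \<Rightarrow> (real \<times> 'a \<Rightarrow> real^2^2) set" where
  "W_set I \<Omega> T = {A \<in> cont_maps (I \<times> \<Omega>) SL2.
     \<forall>E\<in>I. uniform_behavior \<Omega> T (\<lambda>\<omega>. A (E, \<omega>))}"

end

theory Submission
  imports Defs "HOL-Real_Asymp.Real_Asymp"
begin

text \<open>Zero growth is a countable conjunction of conditions on single iterates: for each rate
  \<open>e > 0\<close> some iterate has norms below \<open>exp (\<theta> * n)\<close> with \<open>\<theta> < e\<close>. Each of these conditions is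
  open in the cocycle. If uniform hyperbolicity is open as well, then so is, for each \<open>e\<close>, the
  disjunction \<open>hyperbolic_or_slow\<close> of the two; and a cocycle that satisfies it for all
  \<open>e = 1 / (m + 1)\<close> is either hyperbolic or has zero growth. For a family, an open property
  required at all parameters of a compact set is again open, by
  \<open>openin_loc_unif_fibrewise\<close>. Writing the interval as a countable union of compact sets exhibits
  the families with uniform behavior as a countable intersection of open sets.

  The substance is the openness of uniform hyperbolicity. Call a cocycle peak-free if, for some
  \<open>N\<close> and some factor \<open>\<mu> > 1\<close>, no nonzero orbit \<open>n \<mapsto> A\<^sub>n(\<omega>) v\<close> has its size at time \<open>N\<close> maximal up
  to the factor \<open>\<mu>\<close> among the times \<open>0, \<dots>, 2 * N\<close>. This involves finitely many iterates and
  survives small perturbations. It is equivalent to uniform hyperbolicity, for cocycles with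
  values in a bounded set.

  If a cocycle is peak-free, then the size of an orbit in the interior of a long time interval is
  exponentially small compared with the larger of its end values. An orbit that has not shrunk in
  the middle of the interval must therefore have grown exponentially at the end.

  Conversely, along an orbit whose size stays comparable to a constant, the cocycle is triangular
  with bounded diagonal products, so that its norm grows at most linearly. An orbit with a peak
  always contains a long stretch with comparable ends and no much smaller value in between: either
  one half of the window, or, if the orbit falls below a small level on both sides, the
  stretch between the crossings of this level. This contradicts exponential growth of all
  norms.\<close>

section \<open>Plane linear algebra\<close>

definition cross2 :: "real^2 \<Rightarrow> real^2 \<Rightarrow> real" where
  "cross2 p q = p$1 * q$2 - p$2 * q$1"

lemma norm_real2_sq: "(norm (v::real^2))\<^sup>2 = (v$1)\<^sup>2 + (v$2)\<^sup>2"
  unfolding power2_norm_eq_inner by (simp add: inner_vec_def sum_2 power2_eq_square)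

lemma lagrange_identity_real2:
  "(cross2 p q)\<^sup>2 + (p \<bullet> q)\<^sup>2 = (norm p * norm q)\<^sup>2"
  unfolding power_mult_distrib norm_real2_sq
  by (simp add: cross2_def inner_vec_def sum_2 power2_eq_square algebra_simps)

lemma abs_cross2_le: "\<bar>cross2 p q\<bar> \<le> norm p * norm q"
proof -
  have "(cross2 p q)\<^sup>2 \<le> (norm p * norm q)\<^sup>2"
    using lagrange_identity_real2[of p q] by (metis le_add_same_cancel1 zero_le_power2)
  then show ?thesis
    by (metis abs_le_square_iff abs_mult abs_norm_cancel)
qed

lemma cross2_SL2:
  assumes "M \<in> SL2"
  shows "cross2 (M *v p) (M *v q) = cross2 p q"
proof -
  have "cross2 (M *v p) (M *v q) = det M * cross2 p q"
    by (simp add: cross2_def matrix_vector_mult_def sum_2 det_2 algebra_simps)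
  then show ?thesis using assms by (simp add: SL2_def)
qed

lemma norm_mult_le_opnorm: "norm (M *v v) \<le> opnorm M * norm v"
  by (rule onorm[OF matrix_vector_mul_bounded_linear])

lemma opnorm_leI:
  assumes "\<And>v. norm (M *v v) \<le> b * norm v"
  shows "opnorm M \<le> b"
  by (rule onorm_le) (rule assms)

text \<open>The inverse of a determinant one matrix has the norm of the matrix itself: a parallelogram
  spanned by \<open>v\<close> and its rotation by a right angle keeps its area, and its other side is
  stretched by at most the operator norm.\<close>

lemma norm_le_opnorm_mult_SL2:
  assumes "M \<in> SL2"
  shows "norm v \<le> opnorm M * norm (M *v v)"
proof (cases "v = 0")
  case False
  define w :: "real^2" where "w = vector [- v$2, v$1]"
  have w: "norm w = norm v"
    by (rule power2_eq_imp_eq) (simp_all add: norm_real2_sq, simp add: w_def)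
  have "(norm v)\<^sup>2 = cross2 v w"
    by (simp add: cross2_def w_def norm_real2_sq) (simp add: power2_eq_square)
  also have "\<dots> = cross2 (M *v v) (M *v w)"
    using cross2_SL2[OF assms] by simp
  also have "\<dots> \<le> norm (M *v v) * norm (M *v w)"
    using abs_cross2_le[of "M *v v" "M *v w"] by linarith
  also have "\<dots> \<le> norm (M *v v) * (opnorm M * norm v)"
    using norm_mult_le_opnorm[of M w] w by (intro mult_left_mono) auto
  finally have "norm v * norm v \<le> (opnorm M * norm (M *v v)) * norm v"
    by (simp add: power2_eq_square mult_ac)
  then show ?thesis using False by (simp add: mult_le_cancel_right)
qed simp

definition proj_coeff :: "real^2 \<Rightarrow> real^2 \<Rightarrow> real" where
  "proj_coeff p u = (u \<bullet> p) / (norm p)\<^sup>2"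

lemma norm_proj_coeff_residual:
  assumes "p \<noteq> 0"
  shows "norm (u - proj_coeff p u *\<^sub>R p) = \<bar>cross2 p u\<bar> / norm p"
proof -
  define s where "s = proj_coeff p u"
  have np: "p \<bullet> p > 0" using assms by simp
  have s: "s * (p \<bullet> p) = u \<bullet> p"
    using np by (simp add: s_def proj_coeff_def power2_norm_eq_inner)
  have "(norm (u - s *\<^sub>R p))\<^sup>2 = (norm u)\<^sup>2 - 2 * s * (u \<bullet> p) + s * (s * (p \<bullet> p))"
    by (simp add: power2_norm_eq_inner inner_diff inner_commute algebra_simps)
  also have "\<dots> = (norm u)\<^sup>2 - s * (u \<bullet> p)" using s by simp
  finally have "(norm (u - s *\<^sub>R p))\<^sup>2 * (norm p)\<^sup>2
      = ((norm u)\<^sup>2 - s * (u \<bullet> p)) * (norm p)\<^sup>2"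
    by simp
  also have "\<dots> = (norm u)\<^sup>2 * (norm p)\<^sup>2 - (s * (p \<bullet> p)) * (u \<bullet> p)"
    by (simp add: power2_norm_eq_inner[of p] algebra_simps)
  also have "\<dots> = (norm p * norm u)\<^sup>2 - (p \<bullet> u)\<^sup>2"
    using s by (simp add: power2_eq_square inner_commute algebra_simps)
  also have "\<dots> = \<bar>cross2 p u\<bar>\<^sup>2"
    using lagrange_identity_real2[of p u] by simp
  finally have "(norm (u - s *\<^sub>R p) * norm p)\<^sup>2 = \<bar>cross2 p u\<bar>\<^sup>2"
    by (simp add: power_mult_distrib)
  then have "norm (u - s *\<^sub>R p) * norm p = \<bar>cross2 p u\<bar>"
    by (rule power2_eq_imp_eq) auto
  then show ?thesis using assms by (simp add: s_def field_simps)
qed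

lemma proj_coeff_diff_le:
  assumes "p \<noteq> 0"
  shows "\<bar>proj_coeff p u - s\<bar> \<le> norm (u - s *\<^sub>R p) / norm p"
proof -
  have "(proj_coeff p u - s) * (norm p)\<^sup>2 = (u - s *\<^sub>R p) \<bullet> p"
    using assms by (simp add: proj_coeff_def inner_diff power2_norm_eq_inner field_simps)
  then have "\<bar>proj_coeff p u - s\<bar> * (norm p)\<^sup>2 \<le> norm (u - s *\<^sub>R p) * norm p"
    by (metis Cauchy_Schwarz_ineq2 abs_mult abs_power2)
  then have "(\<bar>proj_coeff p u - s\<bar> * norm p) * norm p \<le> norm (u - s *\<^sub>R p) * norm p"
    by (simp add: power2_eq_square mult_ac)
  then show ?thesis using assms by (simp add: mult_le_cancel_right field_simps)
qed

section \<open>Iterates of a bounded cocycle\<close>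

locale bounded_cocycle =
  fixes \<Omega> :: "'a set" and T :: "'a \<Rightarrow> 'a" and A :: "'a \<Rightarrow> real^2^2" and C :: real
  assumes A_SL2: "A ` \<Omega> \<subseteq> SL2"
    and T_into: "T ` \<Omega> \<subseteq> \<Omega>"
    and A_le: "\<omega> \<in> \<Omega> \<Longrightarrow> opnorm (A \<omega>) \<le> C"
    and C_ge_1: "C \<ge> 1"
begin

abbreviation orb :: "nat \<Rightarrow> 'a \<Rightarrow> real^2 \<Rightarrow> real^2" where
  "orb n \<omega> v \<equiv> cocycle_iter T A n \<omega> *v v"

lemma T_iter_in: "\<omega> \<in> \<Omega> \<Longrightarrow> (T ^^ n) \<omega> \<in> \<Omega>"
  by (induction n) (use T_into in auto)

lemma orb_Suc: "orb (Suc n) \<omega> v = A ((T ^^ n) \<omega>) *v orb n \<omega> v"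
  by (simp add: matrix_vector_mul_assoc)

lemma orb_add: "orb (m + n) \<omega> v = orb m ((T ^^ n) \<omega>) (orb n \<omega> v)"
proof (induction m)
  case (Suc m)
  then show ?case by (simp only: add_Suc orb_Suc) (simp add: funpow_add)
qed simp

lemma iter_SL2: "\<omega> \<in> \<Omega> \<Longrightarrow> cocycle_iter T A n \<omega> \<in> SL2"
proof (induction n)
  case (Suc n)
  have "A ((T ^^ n) \<omega>) \<in> SL2" using A_SL2 T_iter_in Suc.prems by blast
  then show ?case using Suc by (simp add: SL2_def det_mul)
qed (simp add: SL2_def)

lemma opnorm_iter_ge_1: "\<omega> \<in> \<Omega> \<Longrightarrow> opnorm (cocycle_iter T A n \<omega>) \<ge> 1"
  by (intro opnorm_SL2_ge_1 iter_SL2)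

lemma norm_step_le:
  assumes "\<omega> \<in> \<Omega>"
  shows "norm (A \<omega> *v v) \<le> C * norm v"
  using norm_mult_le_opnorm[of "A \<omega>" v] mult_right_mono[OF A_le[OF assms], of "norm v"]
  by simp

lemma norm_orb_le: "\<omega> \<in> \<Omega> \<Longrightarrow> norm (orb n \<omega> v) \<le> C ^ n * norm v"
proof (induction n)
  case (Suc n)
  have "norm (orb (Suc n) \<omega> v) \<le> C * norm (orb n \<omega> v)"
    unfolding orb_Suc by (rule norm_step_le) (rule T_iter_in[OF Suc.prems])
  also have "\<dots> \<le> C * (C ^ n * norm v)"
    using Suc C_ge_1 by (intro mult_left_mono) auto
  finally show ?case by (simp add: mult_ac)
qed simp

lemma opnorm_iter_le: "\<omega> \<in> \<Omega> \<Longrightarrow> opnorm (cocycle_iter T A n \<omega>) \<le> C ^ n"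
  by (rule opnorm_leI) (rule norm_orb_le)

lemma norm_orb_add_le:
  "\<omega> \<in> \<Omega> \<Longrightarrow> norm (orb (m + n) \<omega> v) \<le> C ^ m * norm (orb n \<omega> v)"
  unfolding orb_add by (rule norm_orb_le) (rule T_iter_in)

lemma norm_orb_ge_add:
  assumes "\<omega> \<in> \<Omega>"
  shows "norm (orb n \<omega> v) \<le> C ^ m * norm (orb (m + n) \<omega> v)"
proof -
  have i: "(T ^^ n) \<omega> \<in> \<Omega>" by (rule T_iter_in[OF assms])
  show ?thesis
    using norm_le_opnorm_mult_SL2[OF iter_SL2[OF i], of "orb n \<omega> v" m]
      mult_right_mono[OF opnorm_iter_le[OF i], of "norm (orb (m + n) \<omega> v)" m]
    by (simp add: orb_add)
qed

lemma norm_orb_eq_0_iff: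
  assumes "\<omega> \<in> \<Omega>"
  shows "orb n \<omega> v = 0 \<longleftrightarrow> v = 0"
  using norm_orb_ge_add[OF assms, of 0 v n] by auto

lemma opnorm_iter_mult_le:
  assumes "\<omega> \<in> \<Omega>"
  shows "opnorm (cocycle_iter T A (m + n) \<omega>)
    \<le> opnorm (cocycle_iter T A m ((T ^^ n) \<omega>)) * opnorm (cocycle_iter T A n \<omega>)"
proof (rule opnorm_leI)
  fix v
  have "norm (orb (m + n) \<omega> v) \<le> opnorm (cocycle_iter T A m ((T ^^ n) \<omega>)) * norm (orb n \<omega> v)"
    unfolding orb_add by (rule norm_mult_le_opnorm)
  also have "\<dots> \<le> opnorm (cocycle_iter T A m ((T ^^ n) \<omega>))
      * (opnorm (cocycle_iter T A n \<omega>) * norm v)"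
    using opnorm_iter_ge_1[OF T_iter_in[OF assms], of m n]
    by (intro mult_left_mono norm_mult_le_opnorm) auto
  finally show "norm (orb (m + n) \<omega> v)
    \<le> opnorm (cocycle_iter T A m ((T ^^ n) \<omega>)) * opnorm (cocycle_iter T A n \<omega>) * norm v"
    by (simp add: mult_ac)
qed

section \<open>Reformulations of the two kinds of uniform behavior\<close>

lemma uniformly_hyperbolic_iff_exp:
  "uniformly_hyperbolic \<Omega> T A \<longleftrightarrow>
    (\<exists>c>0. \<forall>\<^sub>F n in sequentially. \<forall>\<omega>\<in>\<Omega>. exp (c * real n) \<le> opnorm (cocycle_iter T A n \<omega>))"
proof
  assume "uniformly_hyperbolic \<Omega> T A"
  then obtain L where L: "L > 0"
    "\<And>\<epsilon>. \<epsilon> > 0 \<Longrightarrow> \<forall>\<^sub>F n in sequentially. \<forall>\<omega>\<in>\<Omega>. growth T A n \<omega> > L - \<epsilon>"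
    unfolding uniformly_hyperbolic_def by blast
  have "\<forall>\<^sub>F n in sequentially. \<forall>\<omega>\<in>\<Omega>. growth T A n \<omega> > L - L/2"
    by (rule L(2)) (use L(1) in simp)
  then have "\<forall>\<^sub>F n in sequentially. \<forall>\<omega>\<in>\<Omega>. exp (L/2 * real n) \<le> opnorm (cocycle_iter T A n \<omega>)"
    using eventually_gt_at_top[of 0]
  proof (eventually_elim)
    case (elim n)
    show ?case
    proof
      fix \<omega> assume w: "\<omega> \<in> \<Omega>"
      then have "L / 2 < growth T A n \<omega>" using elim L(1) by auto
      then have "L / 2 * real n < ln (opnorm (cocycle_iter T A n \<omega>))"
        using elim by (simp add: growth_def field_simps)
      then show "exp (L / 2 * real n) \<le> opnorm (cocycle_iter T A n \<omega>)"
        using opnorm_iter_ge_1[OF w, of n] by (simp add: ln_ge_iff[symmetric])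
    qed
  qed
  then show "\<exists>c>0. \<forall>\<^sub>F n in sequentially. \<forall>\<omega>\<in>\<Omega>. exp (c * real n) \<le> opnorm (cocycle_iter T A n \<omega>)"
    using L(1) by (intro exI[of _ "L/2"]) auto
next
  assume "\<exists>c>0. \<forall>\<^sub>F n in sequentially. \<forall>\<omega>\<in>\<Omega>. exp (c * real n) \<le> opnorm (cocycle_iter T A n \<omega>)"
  then obtain c where c: "c > 0"
    "\<forall>\<^sub>F n in sequentially. \<forall>\<omega>\<in>\<Omega>. exp (c * real n) \<le> opnorm (cocycle_iter T A n \<omega>)"
    by blast
  have "\<forall>\<^sub>F n in sequentially. \<forall>\<omega>\<in>\<Omega>. growth T A n \<omega> > c - \<epsilon>" if "\<epsilon> > 0" for \<epsilon>
    using c(2) eventually_gt_at_top[of 0]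
  proof (eventually_elim)
    case (elim n)
    show ?case
    proof
      fix \<omega> assume w: "\<omega> \<in> \<Omega>"
      have "c * real n \<le> ln (opnorm (cocycle_iter T A n \<omega>))"
        using elim w opnorm_iter_ge_1[OF w, of n] by (simp add: ln_ge_iff)
      then have "c \<le> growth T A n \<omega>"
        using elim by (simp add: growth_def field_simps)
      then show "growth T A n \<omega> > c - \<epsilon>" using that by simp
    qed
  qed
  then show "uniformly_hyperbolic \<Omega> T A"
    unfolding uniformly_hyperbolic_def using c(1) by blast
qed

text \<open>By submultiplicativity a single time at which all norms are small controls all later
  times, so that zero growth is a countable conjunction of conditions on single iterates.\<close>

lemma uniform_zero_growth_iff_single_time:
  "uniform_zero_growth \<Omega> T A \<longleftrightarrow>
    (\<forall>e>0. \<exists>n\<ge>1. \<exists>\<theta><e. \<forall>\<omega>\<in>\<Omega>. opnorm (cocycle_iter T A n \<omega>) \<le> exp (\<theta> * real n))"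
proof
  assume Z: "uniform_zero_growth \<Omega> T A"
  show "\<forall>e>0. \<exists>n\<ge>1. \<exists>\<theta><e. \<forall>\<omega>\<in>\<Omega>. opnorm (cocycle_iter T A n \<omega>) \<le> exp (\<theta> * real n)"
  proof (intro allI impI)
    fix e :: real assume e: "e > 0"
    have "\<forall>\<^sub>F n in sequentially. \<forall>\<omega>\<in>\<Omega>. growth T A n \<omega> < e/2"
      using Z half_gt_zero[OF e] unfolding uniform_zero_growth_def by blast
    then obtain n0 where "\<And>n. n \<ge> n0 \<Longrightarrow> \<forall>\<omega>\<in>\<Omega>. growth T A n \<omega> < e/2"
      by (auto simp: eventually_sequentially)
    then have gr: "\<forall>\<omega>\<in>\<Omega>. growth T A (Suc n0) \<omega> < e/2" by simp
    have "opnorm (cocycle_iter T A (Suc n0) \<omega>) \<le> exp (e/2 * real (Suc n0))" if w: "\<omega> \<in> \<Omega>" for \<omega>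
    proof -
      have "ln (opnorm (cocycle_iter T A (Suc n0) \<omega>)) \<le> e/2 * real (Suc n0)"
        using bspec[OF gr w] unfolding growth_def by (simp add: field_simps del: cocycle_iter.simps)
      then have "exp (ln (opnorm (cocycle_iter T A (Suc n0) \<omega>))) \<le> exp (e/2 * real (Suc n0))"
        by (simp only: exp_le_cancel_iff)
      then show ?thesis
        using opnorm_iter_ge_1[OF w, of "Suc n0"] by (simp del: cocycle_iter.simps)
    qed
    then show "\<exists>n\<ge>1. \<exists>\<theta><e. \<forall>\<omega>\<in>\<Omega>. opnorm (cocycle_iter T A n \<omega>) \<le> exp (\<theta> * real n)"
      using e by (intro exI[of _ "Suc n0"] conjI exI[of _ "e/2"]) auto
  qed
next
  assume H: "\<forall>e>0. \<exists>n\<ge>1. \<exists>\<theta><e. \<forall>\<omega>\<in>\<Omega>. opnorm (cocycle_iter T A n \<omega>) \<le> exp (\<theta> * real n)"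
  have "\<forall>\<^sub>F n in sequentially. \<forall>\<omega>\<in>\<Omega>. growth T A n \<omega> < e" if e: "e > 0" for e
  proof -
    obtain m \<theta> where m: "m \<ge> 1" and th: "\<theta> < e/2"
      and le: "\<And>\<omega>. \<omega> \<in> \<Omega> \<Longrightarrow> opnorm (cocycle_iter T A m \<omega>) \<le> exp (\<theta> * real m)"
      using H[rule_format, of "e/2"] e by auto
    have le': "opnorm (cocycle_iter T A m \<omega>) \<le> exp (e/2 * real m)" if "\<omega> \<in> \<Omega>" for \<omega>
    proof (rule order_trans[OF le[OF that]])
      have "\<theta> * real m \<le> e/2 * real m" using th by (intro mult_right_mono) auto
      then show "exp (\<theta> * real m) \<le> exp (e/2 * real m)" by (simp only: exp_le_cancel_iff)
    qed
    have mult: "opnorm (cocycle_iter T A (q * m + r) \<omega>) \<le> exp (e/2 * real (q * m)) * C ^ r"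
      if w: "\<omega> \<in> \<Omega>" for q r \<omega>
    proof (induction q)
      case 0
      then show ?case using opnorm_iter_le[OF w] by simp
    next
      case (Suc q)
      have "opnorm (cocycle_iter T A (m + (q * m + r)) \<omega>)
          \<le> exp (e/2 * real m) * (exp (e/2 * real (q * m)) * C ^ r)"
        using opnorm_iter_ge_1[OF w, of "q * m + r"]
        by (intro order_trans[OF opnorm_iter_mult_le[OF w]] mult_mono le' T_iter_in w Suc) auto
      then show ?case by (simp add: add_ac distrib_left distrib_right exp_add mult_ac)
    qed
    have "(\<lambda>n. real m * ln C / real n) \<longlonglongrightarrow> 0" by (rule lim_const_over_n)
    then have "\<forall>\<^sub>F n in sequentially. real m * ln C / real n < e/2"
      by (rule order_tendstoD(2)) (use e in simp)
    then show ?thesis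
      using eventually_gt_at_top[of 0]
    proof (eventually_elim)
      case (elim n)
      show ?case
      proof
        fix \<omega> assume w: "\<omega> \<in> \<Omega>"
        define q r where "q = n div m" and "r = n mod m"
        have n: "q * m + r = n" by (simp add: q_def r_def)
        then have "q * m \<le> n" by linarith
        then have qm: "real (q * m) \<le> real n" by (simp only: of_nat_le_iff)
        have "opnorm (cocycle_iter T A n \<omega>) \<le> exp (e/2 * real (q * m)) * C ^ r"
          using mult[OF w, of q r] by (simp add: n)
        also have "\<dots> \<le> exp (e/2 * real n) * C ^ m"
          using e C_ge_1 m n qm by (intro mult_mono power_increasing) (auto simp: r_def)
        finally have "ln (opnorm (cocycle_iter T A n \<omega>)) \<le> ln (exp (e/2 * real n) * C ^ m)"
          using opnorm_iter_ge_1[OF w, of n] by (subst ln_le_cancel_iff) (use C_ge_1 in auto)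
        also have "\<dots> = e/2 * real n + real m * ln C"
          using C_ge_1 by (simp add: ln_mult ln_realpow)
        finally have "growth T A n \<omega> \<le> (e/2 * real n + real m * ln C) / real n"
          using elim by (simp add: growth_def divide_right_mono)
        also have "\<dots> = e/2 + real m * ln C / real n"
          using elim by (simp add: field_simps)
        also have "\<dots> < e" using elim(1) by linarith
        finally show "growth T A n \<omega> < e" .
      qed
    qed
  qed
  then show "uniform_zero_growth \<Omega> T A"
    unfolding uniform_zero_growth_iff[OF A_SL2 T_into] uniform_limit_iff
    using growth_nonneg[OF A_SL2 T_into]
    by (auto simp: dist_real_def elim!: eventually_mono)
qed

section \<open>Peak-free cocycles are uniformly hyperbolic\<close>

text \<open>For \<open>\<mu> > 1\<close> this is a finite-time form of the Sacker--Sell and Mane criterion for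
  hyperbolicity, that no nonzero orbit is bounded in both time directions. Centering the window at
  time \<open>N\<close> expresses this with forward iterates only.\<close>

definition peak_free :: "nat \<Rightarrow> real \<Rightarrow> bool" where
  "peak_free N \<mu> \<longleftrightarrow>
    (\<forall>\<omega>\<in>\<Omega>. \<forall>v. \<exists>j\<le>2*N. \<mu> * norm (orb N \<omega> v) \<le> norm (orb j \<omega> v))"

text \<open>Moving inwards by \<open>N\<close> from both ends of a time interval halves the maximum of an orbit,
  because every value in the smaller interval is at most half of some value in the larger one.\<close>

lemma peak_free_inner_le:
  assumes pf: "peak_free N 2" and w: "\<omega> \<in> \<Omega>"
    and M: "\<And>i. i \<le> n \<Longrightarrow> norm (orb i \<omega> v) \<le> M"
  shows "k * N \<le> i \<Longrightarrow> i + k * N \<le> n \<Longrightarrow> 2 ^ k * norm (orb i \<omega> v) \<le> M"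
proof (induction k arbitrary: i)
  case 0
  then show ?case using M by simp
next
  case (Suc k)
  define i0 where "i0 = i - N"
  have i: "i = N + i0" using Suc.prems by (simp add: i0_def)
  obtain j where j: "j \<le> 2*N"
    "2 * norm (orb N ((T ^^ i0) \<omega>) (orb i0 \<omega> v)) \<le> norm (orb j ((T ^^ i0) \<omega>) (orb i0 \<omega> v))"
    using pf T_iter_in[OF w] unfolding peak_free_def by blast
  have "2 * norm (orb i \<omega> v) \<le> norm (orb (j + i0) \<omega> v)"
    using j(2) by (simp add: orb_add i)
  then have "2 ^ k * (2 * norm (orb i \<omega> v)) \<le> 2 ^ k * norm (orb (j + i0) \<omega> v)"
    by (intro mult_left_mono) auto
  also have "\<dots> \<le> M"
    using Suc.prems j(1) i by (intro Suc.IH) auto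
  finally show ?case by simp
qed

text \<open>The maximum of an orbit over a time interval is attained within \<open>N\<close> steps of an end, hence
  is controlled by the values at the two ends.\<close>

lemma peak_free_max_near_ends:
  assumes pf: "peak_free N 2" and w: "\<omega> \<in> \<Omega>" and i: "i \<le> n"
  shows "norm (orb i \<omega> v) \<le> C ^ N * max (norm v) (norm (orb n \<omega> v))"
proof (cases "v = 0")
  case False
  define M where "M = Max ((\<lambda>i. norm (orb i \<omega> v)) ` {..n})"
  have ub: "norm (orb i \<omega> v) \<le> M" if "i \<le> n" for i
    unfolding M_def using that by (intro Max_ge) auto
  have "M \<in> (\<lambda>i. norm (orb i \<omega> v)) ` {..n}" unfolding M_def by (intro Max_in) auto
  then obtain m where m: "m \<le> n" "M = norm (orb m \<omega> v)" by auto
  have Mpos: "M > 0" using m norm_orb_eq_0_iff[OF w] False by simp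
  have pow: "C ^ l \<le> C ^ N" if "l \<le> N" for l
    using that C_ge_1 by (rule power_increasing)
  have "\<not> (N \<le> m \<and> m + N \<le> n)"
    using peak_free_inner_le[OF pf w ub, of n 1 m] m Mpos by auto
  then consider "m \<le> N" | "n - m \<le> N" by linarith
  then have "M \<le> C ^ N * max (norm v) (norm (orb n \<omega> v))"
  proof cases
    case 1
    have "M \<le> C ^ m * norm v" using norm_orb_le[OF w] m by simp
    also have "\<dots> \<le> C ^ N * max (norm v) (norm (orb n \<omega> v))"
      using pow[OF 1] C_ge_1 by (intro mult_mono) auto
    finally show ?thesis .
  next
    case 2
    have "M \<le> C ^ (n - m) * norm (orb n \<omega> v)"
      using norm_orb_ge_add[OF w, of m v "n - m"] m by simp
    also have "\<dots> \<le> C ^ N * max (norm v) (norm (orb n \<omega> v))"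
      using pow[OF 2] C_ge_1 by (intro mult_mono) auto
    finally show ?thesis .
  qed
  then show ?thesis using ub[OF i] by simp
qed simp

text \<open>An orbit that still has at least half its initial size at time \<open>k * N\<close> is nevertheless
  exponentially small there compared with the larger of its two end values, so the last value must be
  large. Such an orbit exists because an \<open>SL2\<close> matrix has norm at least one.\<close>

lemma peak_free_opnorm_ge:
  assumes pf: "peak_free N 2" and w: "\<omega> \<in> \<Omega>" and k: "2 * (k * N) \<le> n"
    and big: "2 * C ^ N < 2 ^ k"
  shows "2 ^ k \<le> 2 * C ^ N * opnorm (cocycle_iter T A n \<omega>)"
proof -
  have "\<exists>v. norm v < 2 * norm (orb (k * N) \<omega> v)"
  proof (rule ccontr)
    assume "\<not> ?thesis"
    then have "\<And>v. norm (orb (k * N) \<omega> v) \<le> 1/2 * norm v"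
      by (simp add: not_less field_simps)
    then have "opnorm (cocycle_iter T A (k * N) \<omega>) \<le> 1/2" by (rule opnorm_leI)
    then show False using opnorm_iter_ge_1[OF w, of "k * N"] by simp
  qed
  then obtain v where v: "norm v < 2 * norm (orb (k * N) \<omega> v)" by blast
  have v0: "norm v > 0" using v by (metis matrix_vector_mult_0_right norm_zero not_less_iff_gr_or_eq
        mult_zero_right zero_less_norm_iff)
  let ?x = "norm (orb n \<omega> v)"
  have "2 ^ k * norm (orb (k * N) \<omega> v) \<le> C ^ N * max (norm v) ?x"
    using k by (intro peak_free_inner_le[OF pf w peak_free_max_near_ends[OF pf w], of n]) auto
  moreover have "2 ^ k * norm v < 2 ^ k * (2 * norm (orb (k * N) \<omega> v))"
    using v by simp
  ultimately have *: "2 ^ k * norm v < 2 * C ^ N * max (norm v) ?x" by linarith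
  have "\<not> ?x \<le> norm v"
    using * mult_right_mono[of "2 * C ^ N" "2 ^ k" "norm v"] big by (auto simp: max_def)
  then have "2 ^ k * norm v \<le> 2 * C ^ N * ?x" using * by (simp add: max_def split: if_splits)
  also have "\<dots> \<le> 2 * C ^ N * (opnorm (cocycle_iter T A n \<omega>) * norm v)"
    using C_ge_1 by (intro mult_left_mono norm_mult_le_opnorm) auto
  finally have "2 ^ k * norm v \<le> (2 * C ^ N * opnorm (cocycle_iter T A n \<omega>)) * norm v"
    by (simp add: mult_ac)
  then show ?thesis using v0 by (simp add: mult_le_cancel_right)
qed

lemma peak_free_imp_uniformly_hyperbolic:
  assumes pf: "peak_free N 2"
  shows "uniformly_hyperbolic \<Omega> T A"
proof -
  \<comment> \<open>The norm doubles at least once in about \<open>2 * N\<close> steps; half of that rate leaves room for the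
    constant \<open>D\<close> and for the rounding of \<open>n\<close>. The successor avoids a division by zero.\<close>
  define c where "c = ln 2 / (4 * real (Suc N))"
  have c: "c > 0" by (simp add: c_def)
  define D where "D = 2 * C ^ N"
  have D: "D > 0" using C_ge_1 by (simp add: D_def)
  have dtop: "filterlim (\<lambda>n. n div (2 * Suc N)) at_top sequentially"
    by (rule filterlim_at_top_div_const_nat) simp
  have "\<forall>\<^sub>F k in sequentially. D * exp (c * real (2 * Suc N * (k + 1))) \<le> 2 ^ k"
  proof -
    have eq: "c * real (2 * Suc N * (k + 1)) = ln 2 / 2 * real (k + 1)" for k
      unfolding of_nat_mult c_def by (simp add: field_simps del: of_nat_Suc)
    have "\<forall>\<^sub>F k in sequentially. D * exp (ln 2 / 2 * real (k + 1)) \<le> 2 ^ k"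
      using D by real_asymp
    then show ?thesis unfolding eq .
  qed
  moreover have "\<forall>\<^sub>F k in sequentially. D < 2 ^ k" by real_asymp
  ultimately have "\<forall>\<^sub>F k in sequentially.
      D * exp (c * real (2 * Suc N * (k + 1))) \<le> 2 ^ k \<and> D < 2 ^ k"
    by eventually_elim auto
  from eventually_compose_filterlim[OF this dtop]
  have "\<forall>\<^sub>F n in sequentially. D * exp (c * real (2 * Suc N * (n div (2 * Suc N) + 1)))
      \<le> 2 ^ (n div (2 * Suc N)) \<and> D < 2 ^ (n div (2 * Suc N))"
    .
  then have "\<forall>\<^sub>F n in sequentially. \<forall>\<omega>\<in>\<Omega>. exp (c * real n) \<le> opnorm (cocycle_iter T A n \<omega>)"
  proof (eventually_elim)
    case (elim n)
    define k where "k = n div (2 * Suc N)"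
    show ?case
    proof
      fix \<omega> assume w: "\<omega> \<in> \<Omega>"
      have kn: "2 * Suc N * k \<le> n"
        unfolding k_def by (rule times_div_less_eq_dividend)
      have "2 * (k * N) \<le> 2 * Suc N * k" by (simp add: algebra_simps)
      with kn have kn': "2 * (k * N) \<le> n" by linarith
      have pos: "0 < 2 * Suc N" by simp
      have "n < 2 * Suc N * (k + 1)"
        using dividend_less_times_div[of "2 * Suc N" n, OF pos]
        by (simp only: k_def distrib_left mult_1_right add.commute)
      then have "real n \<le> real (2 * Suc N * (k + 1))"
        by (simp only: of_nat_le_iff less_imp_le)
      then have "D * exp (c * real n) \<le> D * exp (c * real (2 * Suc N * (k + 1)))"
        using c D by (simp del: of_nat_Suc of_nat_mult)
      also have "\<dots> \<le> 2 ^ k" using elim by (simp add: k_def)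
      also have "\<dots> \<le> D * opnorm (cocycle_iter T A n \<omega>)"
        using peak_free_opnorm_ge[OF pf w kn'] elim by (simp add: k_def D_def)
      finally show "exp (c * real n) \<le> opnorm (cocycle_iter T A n \<omega>)"
        using D by simp
    qed
  qed
  then show ?thesis unfolding uniformly_hyperbolic_iff_exp using c by blast
qed

section \<open>Uniformly hyperbolic cocycles are peak-free\<close>

text \<open>In the orthonormal frame whose first vector points along the orbit of \<open>p\<close>, the cocycle is upper
  triangular with reciprocal diagonal entries. The off-diagonal entry after \<open>n\<close> steps is a sum of
  \<open>n\<close> terms, one for each step, and each is at most \<open>C * (R/r)\<^sup>2\<close> because the orbit stays above
  \<open>r\<close> and has end values below \<open>R\<close>.\<close>

lemma opnorm_iter_le_linear:
  assumes w: "\<omega> \<in> \<Omega>" and r: "r > 0"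
    and low: "\<And>i. i \<le> n \<Longrightarrow> r \<le> norm (orb i \<omega> p)"
    and R: "norm p \<le> R" "norm (orb n \<omega> p) \<le> R"
  shows "opnorm (cocycle_iter T A n \<omega>) \<le> (R/r)\<^sup>2 * (2 + C * real n)"
proof (rule opnorm_leI)
  fix u
  let ?p = "\<lambda>i. orb i \<omega> p" and ?u = "\<lambda>i. orb i \<omega> u"
  define \<kappa> where "\<kappa> = \<bar>cross2 p u\<bar>"
  \<comment> \<open>The component of the second orbit orthogonal to the first is determined by the invariant
    area \<open>\<kappa>\<close>; only the coefficient \<open>y i\<close> along the first orbit can accumulate.\<close>
  define y where "y = (\<lambda>i. proj_coeff (?p i) (?u i))"
  have nz: "?p i \<noteq> 0" if "i \<le> n" for i using low[OF that] r by auto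
  have p0: "r \<le> norm p" using low[of 0] by simp
  have R0: "r \<le> R" using p0 R by simp
  have kap: "\<bar>cross2 (?p i) (?u i)\<bar> = \<kappa>" for i
    by (simp add: \<kappa>_def cross2_SL2[OF iter_SL2[OF w]])
  have res: "norm (?u i - y i *\<^sub>R ?p i) \<le> \<kappa> / r" if "i \<le> n" for i
    using norm_proj_coeff_residual[OF nz[OF that], of "?u i"] kap[of i] low[OF that] r
    by (simp add: y_def frac_le \<kappa>_def)
  have k0: "\<kappa> \<ge> 0" by (simp add: \<kappa>_def)
  have step: "\<bar>y (Suc i) - y i\<bar> \<le> C * \<kappa> / r\<^sup>2" if i: "Suc i \<le> n" for i
  proof -
    have "?u (Suc i) - y i *\<^sub>R ?p (Suc i) = A ((T ^^ i) \<omega>) *v (?u i - y i *\<^sub>R ?p i)"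
      by (simp only: orb_Suc matrix_vector_mult_diff_distrib matrix_vector_mult_scaleR)
    then have "norm (?u (Suc i) - y i *\<^sub>R ?p (Suc i)) \<le> C * norm (?u i - y i *\<^sub>R ?p i)"
      using norm_step_le[OF T_iter_in[OF w]] by metis
    also have "\<dots> \<le> C * (\<kappa> / r)" using res[of i] i C_ge_1 by (intro mult_left_mono) auto
    finally have "norm (?u (Suc i) - y i *\<^sub>R ?p (Suc i)) / norm (?p (Suc i)) \<le> C * (\<kappa> / r) / r"
      using low[OF i] r k0 C_ge_1 by (intro frac_le) (auto simp del: cocycle_iter.simps)
    then show ?thesis
      using proj_coeff_diff_le[OF nz[OF i], of "?u (Suc i)" "y i"]
      by (simp add: y_def power2_eq_square)
  qed
  have ybound: "\<bar>y i\<bar> \<le> norm u / r + real i * (C * \<kappa> / r\<^sup>2)" if "i \<le> n" for i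
    using that
  proof (induction i)
    case 0
    have "\<bar>y 0\<bar> \<le> norm u / norm p"
      using proj_coeff_diff_le[OF nz[of 0], of "?u 0" 0] by (simp add: y_def)
    also have "\<dots> \<le> norm u / r" using p0 r by (intro frac_le) auto
    finally show ?case by simp
  next
    case (Suc i)
    have "\<bar>y (Suc i)\<bar> \<le> (norm u / r + real i * (C * \<kappa> / r\<^sup>2)) + C * \<kappa> / r\<^sup>2"
      using step[OF Suc.prems] Suc.IH[OF Suc_leD[OF Suc.prems]] by linarith
    then show ?case by (simp only: of_nat_Suc distrib_right mult_1 add_ac)
  qed
  have kle: "\<kappa> \<le> R * norm u"
    unfolding \<kappa>_def using abs_cross2_le[of p u] mult_right_mono[OF R(1), of "norm u"] by simp
  have "norm (?u n) \<le> norm (?u n - y n *\<^sub>R ?p n) + norm (y n *\<^sub>R ?p n)"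
    by (metis diff_add_cancel norm_triangle_ineq)
  also have "\<dots> \<le> \<kappa> / r + \<bar>y n\<bar> * R"
    using res[of n] R by (auto intro!: add_mono mult_left_mono)
  also have "\<dots> \<le> R * norm u / r + (norm u / r + real n * (C * (R * norm u) / r\<^sup>2)) * R"
  proof -
    have "\<bar>y n\<bar> \<le> norm u / r + real n * (C * (R * norm u) / r\<^sup>2)"
      using kle C_ge_1 r
      by (intro order_trans[OF ybound[OF order_refl]] add_mono mult_left_mono divide_right_mono) auto
    then show ?thesis
      using kle r R0 by (intro add_mono mult_right_mono divide_right_mono) auto
  qed
  also have "\<dots> = (2 * (R/r) + (R/r)\<^sup>2 * (C * real n)) * norm u"
    by (simp add: field_simps power2_eq_square)
  also have "\<dots> \<le> ((R/r)\<^sup>2 * (2 + C * real n)) * norm u"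
  proof (rule mult_right_mono)
    have "R/r \<ge> 1" using R0 r by simp
    then have "R/r \<le> (R/r)\<^sup>2" by (simp add: self_le_power)
    then show "2 * (R/r) + (R/r)\<^sup>2 * (C * real n) \<le> (R/r)\<^sup>2 * (2 + C * real n)"
      by (simp add: distrib_left)
  qed simp
  finally show "norm (?u n) \<le> (R/r)\<^sup>2 * (2 + C * real n) * norm u" .
qed

lemma opnorm_segment_le_linear:
  assumes w: "\<omega> \<in> \<Omega>" and r: "r > 0" and ab: "a \<le> b"
    and low: "\<And>i. a \<le> i \<Longrightarrow> i \<le> b \<Longrightarrow> r \<le> norm (orb i \<omega> v)"
    and R: "norm (orb a \<omega> v) \<le> R" "norm (orb b \<omega> v) \<le> R"
  shows "opnorm (cocycle_iter T A (b - a) ((T ^^ a) \<omega>)) \<le> (R/r)\<^sup>2 * (2 + C * real (b - a))"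
proof (rule opnorm_iter_le_linear[OF T_iter_in[OF w] r])
  show "r \<le> norm (orb i ((T ^^ a) \<omega>) (orb a \<omega> v))" if "i \<le> b - a" for i
    using low[of "i + a"] that ab by (simp add: orb_add)
  show "norm (orb (b - a) ((T ^^ a) \<omega>) (orb a \<omega> v)) \<le> R"
    using R(2) ab orb_add[of "b - a" a \<omega> v] by simp
qed (rule R(1))

text \<open>Suppose that an orbit has size one at time \<open>N\<close> and is at most \<open>\<mu>\<close> on the window. If it stays
  above a fixed level \<open>t\<close> from time \<open>N\<close> on, or up to time \<open>N\<close>, the linear estimate contradicts
  exponential growth over \<open>N\<close> steps. Otherwise it falls below \<open>t\<close> on both sides. Between the
  nearest such times the orbit is never much smaller than at these two times, and they are far
  apart when \<open>t\<close> is small: again growth is linear over a long time.\<close>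

lemma uniformly_hyperbolic_imp_peak_free:
  assumes UH: "uniformly_hyperbolic \<Omega> T A" and lam: "\<mu> \<ge> 1"
  shows "\<exists>N. peak_free N \<mu>"
proof -
  obtain c where c: "c > 0" and
    ev: "\<forall>\<^sub>F n in sequentially. \<forall>\<omega>\<in>\<Omega>. exp (c * real n) \<le> opnorm (cocycle_iter T A n \<omega>)"
    using UH unfolding uniformly_hyperbolic_iff_exp by blast
  have "\<forall>\<^sub>F n in sequentially. (C\<^sup>2) * (2 + C * real n) < exp (c * real n)"
    using c C_ge_1 by real_asymp
  with ev have "\<forall>\<^sub>F n in sequentially.
      \<forall>\<omega>\<in>\<Omega>. C\<^sup>2 * (2 + C * real n) < opnorm (cocycle_iter T A n \<omega>)"
    by eventually_elim fastforce
  then obtain n1 where n1: "\<And>n \<omega>. n \<ge> n1 \<Longrightarrow> \<omega> \<in> \<Omega> \<Longrightarrow>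
      C\<^sup>2 * (2 + C * real n) < opnorm (cocycle_iter T A n \<omega>)"
    by (auto simp: eventually_sequentially)
  \<comment> \<open>One step loses at most a factor \<open>C\<close>, so an orbit takes more than \<open>n1\<close> steps from size one to
    below \<open>t\<close>.\<close>
  define t where "t = 1 / C ^ n1"
  have t: "0 < t" "t \<le> 1" using C_ge_1 by (auto simp: t_def)
  have "\<forall>\<^sub>F n in sequentially. (\<mu>/t)\<^sup>2 * (2 + C * real n) < exp (c * real n)"
    using c C_ge_1 t lam by real_asymp
  with ev have "\<forall>\<^sub>F n in sequentially.
      \<forall>\<omega>\<in>\<Omega>. (\<mu>/t)\<^sup>2 * (2 + C * real n) < opnorm (cocycle_iter T A n \<omega>)"
    by eventually_elim fastforce
  then obtain N where N: "\<And>\<omega>. \<omega> \<in> \<Omega> \<Longrightarrow>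
      (\<mu>/t)\<^sup>2 * (2 + C * real N) < opnorm (cocycle_iter T A N \<omega>)"
    by (auto simp: eventually_sequentially)
  have "peak_free N \<mu>"
    unfolding peak_free_def
  proof (intro ballI allI, rule ccontr)
    fix \<omega> v0 assume w: "\<omega> \<in> \<Omega>"
      and "\<not> (\<exists>j\<le>2*N. \<mu> * norm (orb N \<omega> v0) \<le> norm (orb j \<omega> v0))"
    then have peak0: "\<And>j. j \<le> 2*N \<Longrightarrow> norm (orb j \<omega> v0) < \<mu> * norm (orb N \<omega> v0)"
      by (meson not_le)
    define s where "s = norm (orb N \<omega> v0)"
    have "0 < \<mu> * s" using peak0[of N] norm_ge_zero[of "orb N \<omega> v0"] unfolding s_def by linarith
    then have s: "s > 0" using lam by (simp add: zero_less_mult_iff)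
    define v where "v = (1/s) *\<^sub>R v0"
    define x where "x = (\<lambda>i. norm (orb i \<omega> v))"
    have x: "x i = norm (orb i \<omega> v0) / s" for i
      using s by (simp add: x_def v_def matrix_vector_mult_scaleR)
    have xN: "x N = 1" using s by (simp add: x s_def[symmetric])
    have peak: "x j \<le> \<mu>" if "j \<le> 2*N" for j
      using peak0[OF that] s by (simp add: x s_def[symmetric] field_simps)
    have Cx: "x i \<le> C ^ m * x (m + i)" "x (m + i) \<le> C ^ m * x i" for m i
      unfolding x_def by (rule norm_orb_ge_add[OF w], rule norm_orb_add_le[OF w])
    have "\<exists>b\<ge>N. b \<le> 2*N \<and> x b < t"
    proof (rule ccontr)
      assume "\<not> (\<exists>b\<ge>N. b \<le> 2*N \<and> x b < t)"
      then have "\<And>i. N \<le> i \<Longrightarrow> i \<le> 2*N \<Longrightarrow> t \<le> norm (orb i \<omega> v)"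
        by (auto simp: x_def not_less)
      then have "opnorm (cocycle_iter T A (2*N - N) ((T ^^ N) \<omega>))
          \<le> (\<mu>/t)\<^sup>2 * (2 + C * real (2*N - N))"
        using peak[of N] peak[of "2*N"]
        by (intro opnorm_segment_le_linear[OF w t(1), where v = v]) (simp_all add: x_def)
      then show False using N[OF T_iter_in[OF w], of N] by simp
    qed
    then obtain b' where b': "b' \<ge> N" "b' \<le> 2*N" "x b' < t" by blast
    have "\<exists>a\<le>N. x a < t"
    proof (rule ccontr)
      assume "\<not> (\<exists>a\<le>N. x a < t)"
      then have "\<And>i. 0 \<le> i \<Longrightarrow> i \<le> N \<Longrightarrow> t \<le> norm (orb i \<omega> v)"
        by (auto simp: x_def not_less)
      then have "opnorm (cocycle_iter T A (N - 0) ((T ^^ 0) \<omega>))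
          \<le> (\<mu>/t)\<^sup>2 * (2 + C * real (N - 0))"
        using peak[of 0] peak[of N]
        by (intro opnorm_segment_le_linear[OF w t(1), where v = v]) (simp_all add: x_def)
      then show False using N[OF w] by simp
    qed
    then obtain a' where a': "a' \<le> N" "x a' < t" by blast
    define a where "a = (GREATEST i. i \<le> N \<and> x i < t)"
    define b where "b = (LEAST i. i \<ge> N \<and> x i < t)"
    have a: "a \<le> N" "x a < t"
      using GreatestI_nat[of "\<lambda>i. i \<le> N \<and> x i < t" a' N] a' by (auto simp: a_def)
    have amax: "i \<le> a" if "i \<le> N" "x i < t" for i
      unfolding a_def using that by (intro Greatest_le_nat[where b = N]) auto
    have b: "b \<ge> N" "x b < t"
      using LeastI[of "\<lambda>i. i \<ge> N \<and> x i < t" b'] b' by (auto simp: b_def)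
    have bmin: "b \<le> i" if "i \<ge> N" "x i < t" for i
      unfolding b_def using that by (intro Least_le) auto
    have ab: "a < N" "N < b" using a b xN t by (auto simp: order.order_iff_strict)
    have "t / C \<le> x i" if i: "a \<le> i" "i \<le> b" for i
    proof -
      have "t \<le> C * x i"
      proof (cases "x i < t")
        case False
        then show ?thesis using C_ge_1 t mult_mono[of 1 C t "x i"] by auto
      next
        case True
        then consider "i = a" | "i = b" using i amax bmin by (metis le_antisym nle_le)
        then show ?thesis
        proof cases
          case 1
          have "t \<le> x (Suc a)" using amax[of "Suc a"] ab by force
          then show ?thesis using Cx(2)[of 1 a] 1 by simp
        next
          case 2
          have "t \<le> x (b - 1)" using bmin[of "b - 1"] ab by force
          then show ?thesis using Cx(1)[of "b - 1" 1] 2 ab by simp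
        qed
      qed
      then show ?thesis using C_ge_1 by (simp add: field_simps)
    qed
    then have "opnorm (cocycle_iter T A (b - a) ((T ^^ a) \<omega>)) \<le> (t/(t/C))\<^sup>2 * (2 + C * real (b - a))"
      using a b ab t C_ge_1 by (intro opnorm_segment_le_linear[OF w, where v = v]) (auto simp: x_def)
    also have "t/(t/C) = C" using t by simp
    finally have "\<not> n1 \<le> b - a"
      using n1[OF _ T_iter_in[OF w], of "b - a" a] by force
    moreover have "C ^ n1 < C ^ (b - N)"
    proof -
      have "1 \<le> C ^ (b - N) * x b" using Cx(1)[of N "b - N"] xN ab by simp
      also have "\<dots> < C ^ (b - N) * t" using b C_ge_1 by simp
      finally show ?thesis using C_ge_1 by (simp add: t_def field_simps)
    qed
    then have "n1 < b - N" using power_increasing[of "b - N" n1 C] C_ge_1 by linarith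
    ultimately show False using ab by linarith
  qed
  then show ?thesis ..
qed


section \<open>Stability under small perturbations\<close>

lemma iter_perturbation:
  assumes "\<eta> > 0"
  shows "\<exists>\<epsilon>>0. \<forall>B. (\<forall>\<omega>\<in>\<Omega>. opnorm (B \<omega> - A \<omega>) \<le> \<epsilon>) \<longrightarrow>
    (\<forall>j\<le>n. \<forall>\<omega>\<in>\<Omega>. \<forall>v. norm (cocycle_iter T B j \<omega> *v v - orb j \<omega> v) \<le> \<eta> * norm v)"
  using assms
proof (induction n arbitrary: \<eta>)
  case 0
  then show ?case by (auto intro: exI[of _ 1])
next
  case (Suc n)
  define \<zeta> where "\<zeta> = min \<eta> (min 1 (\<eta> / (2 * C)))"
  have z: "\<zeta> > 0" "\<zeta> \<le> \<eta>" "\<zeta> \<le> 1" "C * \<zeta> \<le> \<eta> / 2"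
    using Suc.prems C_ge_1 by (auto simp: \<zeta>_def min_def field_simps)
  obtain \<epsilon>1 where e1: "\<epsilon>1 > 0" and IH: "\<And>B j \<omega> v. \<forall>\<omega>\<in>\<Omega>. opnorm (B \<omega> - A \<omega>) \<le> \<epsilon>1 \<Longrightarrow> j \<le> n \<Longrightarrow> \<omega> \<in> \<Omega> \<Longrightarrow>
      norm (cocycle_iter T B j \<omega> *v v - orb j \<omega> v) \<le> \<zeta> * norm v"
    using Suc.IH[OF z(1)] by blast
  define \<epsilon> where "\<epsilon> = min \<epsilon>1 (\<eta> / (2 * (C ^ n + 1)))"
  have Cn: "C ^ n \<ge> 1" using C_ge_1 by simp
  have e: "\<epsilon> > 0" "\<epsilon> \<le> \<epsilon>1" "\<epsilon> * (C ^ n + 1) \<le> \<eta> / 2"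
  proof -
    have "\<epsilon> \<le> \<eta> / (2 * (C ^ n + 1))" by (simp add: \<epsilon>_def)
    then show "\<epsilon> * (C ^ n + 1) \<le> \<eta> / 2" using Cn by (simp add: field_simps)
  qed (use e1 Cn Suc.prems in \<open>auto simp: \<epsilon>_def intro!: divide_pos_pos\<close>)
  have "norm (cocycle_iter T B j \<omega> *v v - orb j \<omega> v) \<le> \<eta> * norm v"
    if B: "\<forall>\<omega>\<in>\<Omega>. opnorm (B \<omega> - A \<omega>) \<le> \<epsilon>" and j: "j \<le> Suc n" and w: "\<omega> \<in> \<Omega>" for B j \<omega> v
  proof (cases "j \<le> n")
    case True
    then have "norm (cocycle_iter T B j \<omega> *v v - orb j \<omega> v) \<le> \<zeta> * norm v"
      using B e w by (intro IH) auto
    also have "\<dots> \<le> \<eta> * norm v" using z by (intro mult_right_mono) auto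
    finally show ?thesis .
  next
    case False
    then have j': "j = Suc n" using j by simp
    let ?w = "(T ^^ n) \<omega>" and ?b = "cocycle_iter T B n \<omega> *v v"
    have IHn: "norm (?b - orb n \<omega> v) \<le> \<zeta> * norm v"
      using B e w by (intro IH) auto
    have nb: "norm ?b \<le> (C ^ n + 1) * norm v"
    proof -
      have "norm ?b \<le> norm (?b - orb n \<omega> v) + norm (orb n \<omega> v)"
        by (metis diff_add_cancel norm_triangle_ineq)
      also have "\<dots> \<le> 1 * norm v + C ^ n * norm v"
        using IHn norm_orb_le[OF w] z
        by (intro add_mono order_trans[OF IHn] mult_right_mono) auto
      finally show ?thesis by (simp add: algebra_simps)
    qed
    have "cocycle_iter T B j \<omega> *v v - orb j \<omega> v
        = (B ?w - A ?w) *v ?b + A ?w *v (?b - orb n \<omega> v)"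
      by (simp add: j' matrix_vector_mul_assoc[symmetric] matrix_vector_mult_diff_rdistrib
          matrix_vector_mult_diff_distrib)
    then have "norm (cocycle_iter T B j \<omega> *v v - orb j \<omega> v)
        \<le> norm ((B ?w - A ?w) *v ?b) + norm (A ?w *v (?b - orb n \<omega> v))"
      by (metis norm_triangle_ineq)
    also have "\<dots> \<le> \<epsilon> * ((C ^ n + 1) * norm v) + C * (\<zeta> * norm v)"
    proof (rule add_mono)
      have "norm ((B ?w - A ?w) *v ?b) \<le> opnorm (B ?w - A ?w) * norm ?b"
        by (rule norm_mult_le_opnorm)
      also have "\<dots> \<le> \<epsilon> * ((C ^ n + 1) * norm v)"
        using B T_iter_in[OF w] e nb by (intro mult_mono) auto
      finally show "norm ((B ?w - A ?w) *v ?b) \<le> \<epsilon> * ((C ^ n + 1) * norm v)" .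
      show "norm (A ?w *v (?b - orb n \<omega> v)) \<le> C * (\<zeta> * norm v)"
        using IHn C_ge_1
        by (intro order_trans[OF norm_step_le[OF T_iter_in[OF w]]] mult_left_mono) auto
    qed
    also have "\<dots> = (\<epsilon> * (C ^ n + 1) + C * \<zeta>) * norm v" by (simp add: algebra_simps)
    also have "\<dots> \<le> \<eta> * norm v" using e z by (intro mult_right_mono) auto
    finally show ?thesis .
  qed
  then show ?case using e(1) by blast
qed

lemma bounded_cocycle_perturbation:
  assumes "B ` \<Omega> \<subseteq> SL2" and B: "\<forall>\<omega>\<in>\<Omega>. opnorm (B \<omega> - A \<omega>) \<le> 1"
  shows "bounded_cocycle \<Omega> T B (C + 1)"
proof
  fix \<omega> assume w: "\<omega> \<in> \<Omega>"
  show "opnorm (B \<omega>) \<le> C + 1"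
  proof (rule opnorm_leI)
    fix v
    have "B \<omega> *v v = A \<omega> *v v + (B \<omega> - A \<omega>) *v v"
      by (simp add: matrix_vector_mult_diff_rdistrib)
    then have "norm (B \<omega> *v v) \<le> norm (A \<omega> *v v) + norm ((B \<omega> - A \<omega>) *v v)"
      by (metis norm_triangle_ineq)
    also have "norm ((B \<omega> - A \<omega>) *v v) \<le> opnorm (B \<omega> - A \<omega>) * norm v"
      by (rule norm_mult_le_opnorm)
    also have "\<dots> \<le> 1 * norm v" using B w by (intro mult_right_mono) auto
    finally show "norm (B \<omega> *v v) \<le> (C + 1) * norm v"
      using norm_step_le[OF w, of v] by (simp add: algebra_simps)
  qed
qed (use assms T_into C_ge_1 in auto)

text \<open>Peak-freeness concerns a finite window of times only, so it survives a small perturbation of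
  the cocycle at the price of a smaller factor.\<close>

lemma uniformly_hyperbolic_stable:
  assumes "uniformly_hyperbolic \<Omega> T A"
  shows "\<exists>\<epsilon>>0. \<forall>B. B ` \<Omega> \<subseteq> SL2 \<longrightarrow> (\<forall>\<omega>\<in>\<Omega>. opnorm (B \<omega> - A \<omega>) \<le> \<epsilon>) \<longrightarrow>
    uniformly_hyperbolic \<Omega> T B"
proof -
  obtain N where N: "peak_free N 3"
    using uniformly_hyperbolic_imp_peak_free[OF assms, of 3] by auto
  \<comment> \<open>An orbit loses at most a factor \<open>C ^ N\<close> up to time \<open>N\<close>, so the error is at most an eighth of its
    size there. This turns the factor 3 into at least \<open>(3 - 1/8) / (1 + 1/8) > 2\<close>.\<close>
  define \<eta> where "\<eta> = 1 / (8 * C ^ N)"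
  have eta: "\<eta> > 0" using C_ge_1 by (simp add: \<eta>_def)
  obtain \<epsilon> where e: "\<epsilon> > 0" and close: "\<And>B j \<omega> v. \<forall>\<omega>\<in>\<Omega>. opnorm (B \<omega> - A \<omega>) \<le> \<epsilon> \<Longrightarrow>
      j \<le> 2*N \<Longrightarrow> \<omega> \<in> \<Omega> \<Longrightarrow> norm (cocycle_iter T B j \<omega> *v v - orb j \<omega> v) \<le> \<eta> * norm v"
    using iter_perturbation[OF eta, of "2*N"] by blast
  have "uniformly_hyperbolic \<Omega> T B"
    if SL: "B ` \<Omega> \<subseteq> SL2" and B: "\<forall>\<omega>\<in>\<Omega>. opnorm (B \<omega> - A \<omega>) \<le> min \<epsilon> 1" for B
  proof -
    interpret B: bounded_cocycle \<Omega> T B "C + 1"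
      using B by (intro bounded_cocycle_perturbation SL) auto
    have "B.peak_free N 2"
      unfolding B.peak_free_def
    proof (intro ballI allI)
      fix \<omega> v assume w: "\<omega> \<in> \<Omega>"
      obtain j where j: "j \<le> 2*N" "3 * norm (orb N \<omega> v) \<le> norm (orb j \<omega> v)"
        using N w unfolding peak_free_def by blast
      have cl: "\<bar>norm (B.orb i \<omega> v) - norm (orb i \<omega> v)\<bar> \<le> \<eta> * norm v" if "i \<le> 2*N" for i
        using order_trans[OF norm_triangle_ineq3 close[of B i \<omega> v]] B that w by auto
      have "norm v \<le> C ^ N * norm (orb N \<omega> v)"
        using norm_orb_ge_add[OF w, of 0 v N] by simp
      then have "\<eta> * norm v \<le> norm (orb N \<omega> v) / 8"
        using C_ge_1 by (simp add: \<eta>_def field_simps)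
      then have "2 * norm (B.orb N \<omega> v) \<le> norm (B.orb j \<omega> v)"
        using cl[of N] cl[OF j(1)] j(2) norm_ge_zero[of "orb N \<omega> v"] by linarith
      then show "\<exists>j\<le>2*N. 2 * norm (B.orb N \<omega> v) \<le> norm (B.orb j \<omega> v)"
        using j(1) by blast
    qed
    then show ?thesis by (rule B.peak_free_imp_uniformly_hyperbolic)
  qed
  moreover have "min \<epsilon> 1 > 0" using e by simp
  ultimately show ?thesis by blast
qed

lemma opnorm_iter_le_exp_stable:
  assumes th: "\<theta> < e" and n: "n \<ge> 1"
    and le: "\<forall>\<omega>\<in>\<Omega>. opnorm (cocycle_iter T A n \<omega>) \<le> exp (\<theta> * real n)"
  shows "\<exists>\<epsilon>>0. \<forall>B. (\<forall>\<omega>\<in>\<Omega>. opnorm (B \<omega> - A \<omega>) \<le> \<epsilon>) \<longrightarrow>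
    (\<exists>\<theta>'<e. \<forall>\<omega>\<in>\<Omega>. opnorm (cocycle_iter T B n \<omega>) \<le> exp (\<theta>' * real n))"
proof -
  define \<theta>' where "\<theta>' = (\<theta> + e) / 2"
  have th': "\<theta> < \<theta>'" "\<theta>' < e" using th by (auto simp: \<theta>'_def)
  define \<eta> where "\<eta> = exp (\<theta>' * real n) - exp (\<theta> * real n)"
  have eta: "\<eta> > 0" using th' n by (simp add: \<eta>_def)
  obtain \<epsilon> where e: "\<epsilon> > 0" and close: "\<And>B \<omega> v. \<forall>\<omega>\<in>\<Omega>. opnorm (B \<omega> - A \<omega>) \<le> \<epsilon> \<Longrightarrow>
      \<omega> \<in> \<Omega> \<Longrightarrow> norm (cocycle_iter T B n \<omega> *v v - orb n \<omega> v) \<le> \<eta> * norm v"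
    using iter_perturbation[OF eta, of n] by blast
  have "opnorm (cocycle_iter T B n \<omega>) \<le> exp (\<theta>' * real n)"
    if B: "\<forall>\<omega>\<in>\<Omega>. opnorm (B \<omega> - A \<omega>) \<le> \<epsilon>" and w: "\<omega> \<in> \<Omega>" for B \<omega>
  proof (rule opnorm_leI)
    fix v
    have "norm (cocycle_iter T B n \<omega> *v v)
        \<le> norm (cocycle_iter T B n \<omega> *v v - orb n \<omega> v) + norm (orb n \<omega> v)"
      by (metis diff_add_cancel norm_triangle_ineq)
    also have "\<dots> \<le> \<eta> * norm v + exp (\<theta> * real n) * norm v"
      using close[OF B w] le w
      by (intro add_mono order_trans[OF norm_mult_le_opnorm] mult_right_mono) auto
    also have "\<dots> = exp (\<theta>' * real n) * norm v" by (simp add: \<eta>_def algebra_simps)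
    finally show "norm (cocycle_iter T B n \<omega> *v v) \<le> exp (\<theta>' * real n) * norm v" .
  qed
  then show ?thesis using e th'(2) by blast
qed

end

text \<open>The strict inequality \<open>\<theta> < e\<close> gives a margin that is uniform in the base point, which makes
  the condition open.\<close>

definition hyperbolic_or_slow :: "'a set \<Rightarrow> ('a \<Rightarrow> 'a) \<Rightarrow> real \<Rightarrow> ('a \<Rightarrow> real^2^2) \<Rightarrow> bool" where
  "hyperbolic_or_slow \<Omega> T e A \<longleftrightarrow> uniformly_hyperbolic \<Omega> T A \<or>
    (\<exists>n\<ge>1. \<exists>\<theta><e. \<forall>\<omega>\<in>\<Omega>. opnorm (cocycle_iter T A n \<omega>) \<le> exp (\<theta> * real n))"

lemma opnorm_le_norm: "opnorm M \<le> 4 * norm M"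
proof -
  have "\<bar>M $ i $ j\<bar> \<le> norm M" for i j
    by (rule order_trans[OF component_le_norm_cart Finite_Cartesian_Product.norm_nth_le])
  then show ?thesis using onorm_le_matrix_component[of M "norm M"] by simp
qed

lemma continuous_imp_bounded_cocycle:
  fixes \<Omega> :: "'a::metric_space set"
  assumes "compact \<Omega>" and "continuous_on \<Omega> A" and "A ` \<Omega> \<subseteq> SL2" and "T ` \<Omega> \<subseteq> \<Omega>"
  obtains C where "bounded_cocycle \<Omega> T A C"
proof -
  obtain b where b: "\<And>\<omega>. \<omega> \<in> \<Omega> \<Longrightarrow> norm (A \<omega>) \<le> b"
    using compact_imp_bounded[OF compact_continuous_image[OF assms(2,1)]]
    by (auto simp: bounded_iff)
  have "opnorm (A \<omega>) \<le> max 1 (4 * b)" if "\<omega> \<in> \<Omega>" for \<omega>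
    using opnorm_le_norm[of "A \<omega>"] b[OF that] by simp
  then have "bounded_cocycle \<Omega> T A (max 1 (4 * b))"
    using assms by unfold_locales auto
  then show ?thesis by (rule that)
qed

lemma hyperbolic_or_slow_stable:
  fixes \<Omega> :: "'a::metric_space set"
  assumes "compact \<Omega>" and "continuous_on \<Omega> A" and "A ` \<Omega> \<subseteq> SL2" and "T ` \<Omega> \<subseteq> \<Omega>"
    and A: "hyperbolic_or_slow \<Omega> T e A"
  shows "\<exists>\<epsilon>>0. \<forall>B. B ` \<Omega> \<subseteq> SL2 \<longrightarrow> (\<forall>\<omega>\<in>\<Omega>. dist (B \<omega>) (A \<omega>) < \<epsilon>) \<longrightarrow>
    hyperbolic_or_slow \<Omega> T e B"
proof -
  obtain C where "bounded_cocycle \<Omega> T A C"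
    using continuous_imp_bounded_cocycle[OF assms(1-4)] .
  then interpret bounded_cocycle \<Omega> T A C .
  have "\<exists>\<epsilon>>0. \<forall>B. B ` \<Omega> \<subseteq> SL2 \<longrightarrow> (\<forall>\<omega>\<in>\<Omega>. opnorm (B \<omega> - A \<omega>) \<le> \<epsilon>) \<longrightarrow>
      hyperbolic_or_slow \<Omega> T e B"
  proof (cases "uniformly_hyperbolic \<Omega> T A")
    case True
    then show ?thesis
      using uniformly_hyperbolic_stable unfolding hyperbolic_or_slow_def by blast
  next
    case False
    then obtain n \<theta> where n: "n \<ge> 1" "\<theta> < e"
      "\<forall>\<omega>\<in>\<Omega>. opnorm (cocycle_iter T A n \<omega>) \<le> exp (\<theta> * real n)"
      using A unfolding hyperbolic_or_slow_def by blast
    obtain \<epsilon> where \<epsilon>: "\<epsilon> > 0" "\<And>B. \<forall>\<omega>\<in>\<Omega>. opnorm (B \<omega> - A \<omega>) \<le> \<epsilon> \<Longrightarrow>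
        \<exists>\<theta>'<e. \<forall>\<omega>\<in>\<Omega>. opnorm (cocycle_iter T B n \<omega>) \<le> exp (\<theta>' * real n)"
      using opnorm_iter_le_exp_stable[OF n(2,1,3)] by blast
    show ?thesis
      unfolding hyperbolic_or_slow_def using \<epsilon> n(1) by (intro exI[of _ \<epsilon>]) auto
  qed
  then obtain \<epsilon> where e: "\<epsilon> > 0" and st: "\<And>B. B ` \<Omega> \<subseteq> SL2 \<Longrightarrow>
      \<forall>\<omega>\<in>\<Omega>. opnorm (B \<omega> - A \<omega>) \<le> \<epsilon> \<Longrightarrow> hyperbolic_or_slow \<Omega> T e B"
    by blast
  have "opnorm (B \<omega> - A \<omega>) \<le> \<epsilon>" if "dist (B \<omega>) (A \<omega>) < \<epsilon> / 4" for B \<omega>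
    using opnorm_le_norm[of "B \<omega> - A \<omega>"] that by (simp add: dist_norm)
  then show ?thesis using e st by (intro exI[of _ "\<epsilon>/4"]) auto
qed

section \<open>From cocycles to families of cocycles\<close>

text \<open>A family on \<open>K \<times> \<Omega>\<close> is uniformly continuous, so nearby parameters have uniformly close
  cocycles, and finitely many parameters suffice to choose one margin of stability.\<close>

lemma openin_loc_unif_fibrewise:
  fixes \<Omega> :: "'a::metric_space set" and I :: "'e::metric_space set" and V :: "'b::metric_space set"
  assumes Om: "compact \<Omega>" and K: "compact K" "K \<subseteq> I"
    and stable: "\<And>A. continuous_on \<Omega> A \<Longrightarrow> A ` \<Omega> \<subseteq> V \<Longrightarrow> Q A \<Longrightarrow>
      \<exists>\<epsilon>>0. \<forall>B. B ` \<Omega> \<subseteq> V \<longrightarrow> (\<forall>\<omega>\<in>\<Omega>. dist (B \<omega>) (A \<omega>) < \<epsilon>) \<longrightarrow> Q B"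
  shows "openin (loc_unif_topology (I \<times> \<Omega>) V)
    {f \<in> cont_maps (I \<times> \<Omega>) V. \<forall>E\<in>K. Q (\<lambda>\<omega>. f (E, \<omega>))}"
  unfolding openin_loc_unif_topology loc_unif_openin_def
proof (intro conjI ballI)
  fix f assume "f \<in> {f \<in> cont_maps (I \<times> \<Omega>) V. \<forall>E\<in>K. Q (\<lambda>\<omega>. f (E, \<omega>))}"
  then have f: "continuous_on (I \<times> \<Omega>) f" "f \<in> I \<times> \<Omega> \<rightarrow> V" and Q: "\<And>E. E \<in> K \<Longrightarrow> Q (\<lambda>\<omega>. f (E, \<omega>))"
    by (auto simp: cont_maps_def PiE_def)
  have sub: "K \<times> \<Omega> \<subseteq> I \<times> \<Omega>" using K by auto
  have cK: "compact (K \<times> \<Omega>)" using K Om by (intro compact_Times)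
  have uc: "uniformly_continuous_on (K \<times> \<Omega>) f"
    using cK continuous_on_subset[OF f(1) sub] by (intro compact_uniformly_continuous)
  have "\<exists>\<epsilon>>0. \<forall>B. B ` \<Omega> \<subseteq> V \<longrightarrow> (\<forall>\<omega>\<in>\<Omega>. dist (B \<omega>) (f (E, \<omega>)) < \<epsilon>) \<longrightarrow> Q B" if E: "E \<in> K" for E
  proof (rule stable[OF _ _ Q[OF E]])
    show "continuous_on \<Omega> (\<lambda>\<omega>. f (E, \<omega>))"
      using E K by (intro continuous_on_compose2[OF f(1)] continuous_intros) auto
    show "(\<lambda>\<omega>. f (E, \<omega>)) ` \<Omega> \<subseteq> V" using E K f(2) by auto
  qed
  then obtain \<epsilon> where eps: "\<And>E. E \<in> K \<Longrightarrow> \<epsilon> E > 0" and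
    st: "\<And>E B. E \<in> K \<Longrightarrow> B ` \<Omega> \<subseteq> V \<Longrightarrow> \<forall>\<omega>\<in>\<Omega>. dist (B \<omega>) (f (E, \<omega>)) < \<epsilon> E \<Longrightarrow> Q B"
    by metis
  have "\<exists>d>0. \<forall>x\<in>K\<times>\<Omega>. \<forall>x'\<in>K\<times>\<Omega>. dist x' x < d \<longrightarrow> dist (f x') (f x) < \<epsilon> E / 2" if "E \<in> K" for E
    using uc eps[OF that] unfolding uniformly_continuous_on_def by (meson half_gt_zero)
  then obtain d where d: "\<And>E. E \<in> K \<Longrightarrow> d E > 0" and
    near: "\<And>E x x'. E \<in> K \<Longrightarrow> x \<in> K \<times> \<Omega> \<Longrightarrow> x' \<in> K \<times> \<Omega> \<Longrightarrow> dist x' x < d E \<Longrightarrow>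
      dist (f x') (f x) < \<epsilon> E / 2"
    by metis
  have "K \<subseteq> (\<Union>E\<in>K. ball E (d E))" using d by force
  then obtain F where F: "F \<subseteq> K" "finite F" "K \<subseteq> (\<Union>E\<in>F. ball E (d E))"
    using compactE_image[OF K(1), of K "\<lambda>E. ball E (d E)"] by blast
  define \<delta> where "\<delta> = Min (insert 1 (\<epsilon> ` F)) / 2"
  have del: "\<delta> > 0" using F eps by (auto simp: \<delta>_def)
  have del_le: "\<delta> \<le> \<epsilon> E / 2" if "E \<in> F" for E
    using that F(2) by (auto simp: \<delta>_def intro!: Min_le)
  have "Q (\<lambda>\<omega>. g (E', \<omega>))"
    if g: "g \<in> cont_maps (I \<times> \<Omega>) V" "\<forall>x\<in>K\<times>\<Omega>. dist (g x) (f x) < \<delta>" and E': "E' \<in> K" for g E'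
  proof -
    obtain E where E: "E \<in> F" "E' \<in> ball E (d E)" using F(3) E' by blast
    have EK: "E \<in> K" using E F by blast
    have "dist (g (E', \<omega>)) (f (E, \<omega>)) < \<epsilon> E" if w: "\<omega> \<in> \<Omega>" for \<omega>
    proof -
      have "dist (f (E', \<omega>)) (f (E, \<omega>)) < \<epsilon> E / 2"
        using near[OF EK, of "(E, \<omega>)" "(E', \<omega>)"] E E' EK w
        by (simp add: dist_Pair_Pair dist_commute)
      moreover have "dist (g (E', \<omega>)) (f (E', \<omega>)) < \<epsilon> E / 2"
        using g(2) E' w del_le[OF E(1)] by force
      ultimately show ?thesis
        using dist_triangle[of "g (E', \<omega>)" "f (E, \<omega>)" "f (E', \<omega>)"] by linarith
    qed
    moreover have "(\<lambda>\<omega>. g (E', \<omega>)) ` \<Omega> \<subseteq> V"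
      using g(1) E' K by (auto simp: cont_maps_def PiE_def Pi_def)
    ultimately show ?thesis using st[OF EK] by blast
  qed
  then show "\<exists>K' \<epsilon>. compact K' \<and> K' \<subseteq> I \<times> \<Omega> \<and> \<epsilon> > 0 \<and>
      {g \<in> cont_maps (I \<times> \<Omega>) V. \<forall>x\<in>K'. dist (g x) (f x) < \<epsilon>}
        \<subseteq> {f \<in> cont_maps (I \<times> \<Omega>) V. \<forall>E\<in>K. Q (\<lambda>\<omega>. f (E, \<omega>))}"
    using cK sub del by (intro exI[of _ "K \<times> \<Omega>"] exI[of _ \<delta>]) auto
qed auto

text \<open>Compact subintervals with rational ends in \<open>I\<close> miss at most the least and the greatest element
  of \<open>I\<close>, so these are admitted as ends too.\<close>

lemma interval_countable_compact_exhaustion: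
  assumes I: "is_interval (I :: real set)"
  obtains \<F> where "countable \<F>" "\<And>K. K \<in> \<F> \<Longrightarrow> compact K" "\<Union>\<F> = I"
proof -
  define lo where "lo = {x\<in>I. \<forall>y\<in>I. x \<le> y}"
  define hi where "hi = {x\<in>I. \<forall>y\<in>I. y \<le> x}"
  define D where "D = (\<rat> \<inter> I) \<union> lo \<union> hi"
  have lo: "countable lo"
  proof (cases "lo = {}")
    case False
    then obtain x where "x \<in> lo" by blast
    then have "lo \<subseteq> {x}" by (auto simp: lo_def intro: antisym)
    then show ?thesis by (rule countable_subset) simp
  qed simp
  have hi: "countable hi"
  proof (cases "hi = {}")
    case False
    then obtain x where "x \<in> hi" by blast
    then have "hi \<subseteq> {x}" by (auto simp: hi_def intro: antisym)
    then show ?thesis by (rule countable_subset) simp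
  qed simp
  have D: "countable D" "D \<subseteq> I"
    using lo hi by (auto simp: D_def lo_def hi_def countable_rat)
  have I': "\<And>a b x. a \<in> I \<Longrightarrow> b \<in> I \<Longrightarrow> a \<le> x \<Longrightarrow> x \<le> b \<Longrightarrow> x \<in> I"
    using I unfolding is_interval_1 by blast
  have left: "\<exists>a\<in>D. a \<le> x" if x: "x \<in> I" for x
  proof (cases "x \<in> lo")
    case False
    then obtain y where y: "y \<in> I" "y < x" using x by (auto simp: lo_def not_le)
    obtain q where "q \<in> \<rat>" "y < q" "q < x" using Rats_dense_in_real[OF y(2)] by blast
    then show ?thesis using I'[OF y(1) x, of q] by (auto simp: D_def intro!: bexI[of _ q])
  qed (auto simp: D_def)
  have right: "\<exists>b\<in>D. x \<le> b" if x: "x \<in> I" for x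
  proof (cases "x \<in> hi")
    case False
    then obtain y where y: "y \<in> I" "x < y" using x by (auto simp: hi_def not_le)
    obtain q where "q \<in> \<rat>" "x < q" "q < y" using Rats_dense_in_real[OF y(2)] by blast
    then show ?thesis using I'[OF x y(1), of q] by (auto simp: D_def intro!: bexI[of _ q])
  qed (auto simp: D_def)
  show ?thesis
  proof (rule that[of "(\<lambda>(a, b). {a..b}) ` (D \<times> D)"])
    show "\<Union>((\<lambda>(a, b). {a..b}) ` (D \<times> D)) = I"
    proof (intro subset_antisym subsetI)
      fix x assume "x \<in> \<Union>((\<lambda>(a, b). {a..b}) ` (D \<times> D))"
      then obtain a b where "a \<in> D" "b \<in> D" "a \<le> x" "x \<le> b" by auto
      then show "x \<in> I" using D(2) I' by blast
    next
      fix x assume "x \<in> I"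
      then obtain a b where "a \<in> D" "b \<in> D" "a \<le> x" "x \<le> b" using left right by blast
      then show "x \<in> \<Union>((\<lambda>(a, b). {a..b}) ` (D \<times> D))"
        by (intro UnionI[of "{a..b}"]) force+
    qed
  qed (use D in auto)
qed

theorem theorem1p2:
  fixes \<Omega> :: "'a::metric_space set" and T :: "'a \<Rightarrow> 'a" and I :: "real set"
  assumes "dynamical_system \<Omega> T"
    and "is_interval I"
  shows "gdelta_in (loc_unif_topology (I \<times> \<Omega>) SL2) (W_set I \<Omega> T)"
proof -
  have Om: "compact \<Omega>" and T: "T ` \<Omega> \<subseteq> \<Omega>"
    using assms(1) by (auto simp: dynamical_system_def homeomorphism_def)
  obtain \<F> where \<F>: "countable \<F>" "\<And>K. K \<in> \<F> \<Longrightarrow> compact K" "\<Union>\<F> = I"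
    using interval_countable_compact_exhaustion[OF assms(2)] by metis
  \<comment> \<open>The empty set is added to the exhaustion so that the intersection is taken over a nonempty
    collection even if \<open>I\<close> is empty.\<close>
  define G where "G = (\<lambda>(K, m). {f \<in> cont_maps (I \<times> \<Omega>) SL2.
    \<forall>E\<in>K. hyperbolic_or_slow \<Omega> T (inverse (real (Suc m))) (\<lambda>\<omega>. f (E, \<omega>))})"
  have "gdelta_in (loc_unif_topology (I \<times> \<Omega>) SL2) (G (K, m))" if "K \<in> insert {} \<F>" for K m
    using that \<F>
    by (auto simp: G_def intro!: open_imp_gdelta_in openin_loc_unif_fibrewise Om
        hyperbolic_or_slow_stable T)
  then have "gdelta_in (loc_unif_topology (I \<times> \<Omega>) SL2) (\<Inter>(G ` (insert {} \<F> \<times> UNIV)))"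
    using \<F>(1) by (intro gdelta_in_Inter) auto
  also have "\<Inter>(G ` (insert {} \<F> \<times> UNIV)) = W_set I \<Omega> T"
  proof -
    have ub: "uniform_behavior \<Omega> T (\<lambda>\<omega>. f (E, \<omega>)) \<longleftrightarrow>
        (\<forall>m. hyperbolic_or_slow \<Omega> T (inverse (real (Suc m))) (\<lambda>\<omega>. f (E, \<omega>)))"
      if f: "f \<in> cont_maps (I \<times> \<Omega>) SL2" and E: "E \<in> I" for f E
    proof -
      let ?A = "\<lambda>\<omega>. f (E, \<omega>)"
      have "continuous_on (I \<times> \<Omega>) f" using f by (simp add: cont_maps_def)
      then have "continuous_on \<Omega> ?A"
        by (rule continuous_on_compose2) (use E in \<open>auto intro!: continuous_intros\<close>)
      moreover have "?A ` \<Omega> \<subseteq> SL2" using f E by (auto simp: cont_maps_def)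
      ultimately obtain C where "bounded_cocycle \<Omega> T ?A C"
        using continuous_imp_bounded_cocycle[OF Om _ _ T] by blast
      then interpret bounded_cocycle \<Omega> T ?A C .
      have "(\<forall>m. \<exists>n\<ge>1. \<exists>\<theta><inverse (real (Suc m)).
            \<forall>\<omega>\<in>\<Omega>. opnorm (cocycle_iter T ?A n \<omega>) \<le> exp (\<theta> * real n))
          \<longleftrightarrow> uniform_zero_growth \<Omega> T ?A"
        unfolding uniform_zero_growth_iff_single_time
      proof (intro iffI allI impI)
        fix e :: real
        assume "e > 0" and H: "\<forall>m. \<exists>n\<ge>1. \<exists>\<theta><inverse (real (Suc m)).
            \<forall>\<omega>\<in>\<Omega>. opnorm (cocycle_iter T ?A n \<omega>) \<le> exp (\<theta> * real n)"
        then obtain m where m: "inverse (real (Suc m)) < e" using reals_Archimedean by blast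
        from H[rule_format, of m] m
        show "\<exists>n\<ge>1. \<exists>\<theta><e. \<forall>\<omega>\<in>\<Omega>. opnorm (cocycle_iter T ?A n \<omega>) \<le> exp (\<theta> * real n)"
          by (meson order.strict_trans)
      qed simp
      then show ?thesis
        unfolding uniform_behavior_def hyperbolic_or_slow_def by blast
    qed
    show ?thesis
    proof (intro subset_antisym subsetI)
      fix f assume f: "f \<in> \<Inter>(G ` (insert {} \<F> \<times> UNIV))"
      then have fc: "f \<in> cont_maps (I \<times> \<Omega>) SL2" by (auto simp: G_def)
      have "uniform_behavior \<Omega> T (\<lambda>\<omega>. f (E, \<omega>))" if E: "E \<in> I" for E
      proof -
        obtain K where "K \<in> \<F>" "E \<in> K" using E \<F>(3) by blast
        then show ?thesis unfolding ub[OF fc E] using f by (auto simp: G_def)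
      qed
      then show "f \<in> W_set I \<Omega> T" using fc by (simp add: W_set_def)
    next
      fix f assume "f \<in> W_set I \<Omega> T"
      then have fc: "f \<in> cont_maps (I \<times> \<Omega>) SL2"
        and "\<forall>E\<in>I. uniform_behavior \<Omega> T (\<lambda>\<omega>. f (E, \<omega>))"
        by (auto simp: W_set_def)
      then have "\<forall>E\<in>I. \<forall>m. hyperbolic_or_slow \<Omega> T (inverse (real (Suc m))) (\<lambda>\<omega>. f (E, \<omega>))"
        using ub[OF fc] by blast
      moreover have "\<Union>(insert {} \<F>) = I" using \<F>(3) by simp
      ultimately show "f \<in> \<Inter>(G ` (insert {} \<F> \<times> UNIV))"
        using fc unfolding G_def by blast
    qed
  qed
  finally show ?thesis .
qed

end
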